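(* Consider $\mathbb{O}^2\cong\mathbb{R}^{16}$ as a real analytic manifold equipped with the standard Euclidean metric $\mathrm{d}s^2$. Let $\mathcal{F}$ be any (real analytic) singular foliation on $\mathbb{O}^2$ whose leaf decomposition is the singular octonionic Hopf leaf decomposition $\mathcal{L}_{OH}$. Then the triple $(\mathbb{O}^2,\mathrm{d}s^2,\mathcal{F})$ induces a singular Riemannian foliation in the sense of Molino, but it is not a module singular Riemannian foliation.
   Context: $\mathbb{O}$ denotes the octonions: the 8-dimensional real unital non-associative algebra with orthonormal basis $e_0=1,e_1,\dots,e_7$ and $e_i\cdot e_j=-\delta_{ij}1+\sum_k\epsilon_{ijk}e_k$ for $1\le i,j\le 7$, where $\epsilon_{ijk}$ is completely antisymmetric, equal to $1$ for $ijk\in\{123,145,176,246,257,347,365\}$, and $0$ for all triples that are not permutations of these; $\langle\cdot,\cdot\rangle$ and $\|\cdot\|$ are the corresponding Euclidean inner product and norm. Singular octonionic Hopf leaf decomposition $\mathcal{L}_{OH}$ of $\mathbb{O}^2$: for $m\in\mathbb{O}$ let $l_m=\{(x,m\cdot x):x\in\mathbb{O}\}$ and let $l_\infty=\{(0,x):x\in\mathbb{O}\}$. For $r>0$ let $\mathrm{S}(r)=\{(x,y)\in\mathbb{O}^2:\|x\|^2+\|y\|^2=r^2\}$. The leaves of $\mathcal{L}_{OH}$ are $l_m\cap \mathrm{S}(r)$ ($m\in\mathbb{O}$, $r>0$), $l_\infty\cap \mathrm{S}(r)$ ($r>0$), and the origin $\{(0,0)\}$. Real analytic singular foliation on a real analytic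 manifold $M$: with $\mathcal{O}$ the sheaf of real analytic functions and $\mathfrak{X}$ the sheaf of real analytic vector fields, it is a subsheaf $\mathcal{F}\subset\mathfrak{X}$ of $\mathcal{O}$-modules such that (i) every point has a neighbourhood $U$ and finitely many $X_1,\dots,X_N\in\mathcal{F}(U)$ with $\mathcal{F}(V)=\langle X_1|_V,\dots,X_N|_V\rangle_{\mathcal{O}(V)}$ for all open $V\subset U$, and (ii) each $\mathcal{F}(U)$ is closed under the Lie bracket. The leaf through $q$ is the set of points that can be joined to $q$ by flows of finitely many (local) vector fields in $\mathcal{F}$; the leaves form the leaf decomposition of $\mathcal{F}$. Let $\mathcal{F}$ be a singular foliation on a Riemannian manifold $(M,g)$. It induces a singular Riemannian foliation in the sense of Molino if every geodesic that starts perpendicular to a leaf stays perpendicular to all the leaves it meets. The triple $(M,g,\mathcal{F})$ is a module singular Riemannian foliation if for every open $U\subset M$ and every $X\in\mathcal{F}(U)$ one has $\mathcal{L}_Xg\in\Omega^1(U)\odot g_\flat(\mathcal{F}(U))$, where $\mathcal{L}_X$ is the Lie derivative, $g_\flat:TM\to T^*M$, $v\mapsto g(v,\cdot)$, $\odot$ is the symmetric product of 1-forms, and the right-hand side denotes finite sums of such products (with real analytic 1-forms). *)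

theory Defs
  imports "HOL-Analysis.Analysis"
begin

section \<open>Octonions\<close>

text \<open>The index type \<open>8\<close> consists of \<open>0, \<dots>, 7\<close>, so \<open>axis i 1\<close> is the basis vector \<open>e\<^sub>i\<close>.
  Norm and inner product are the Euclidean ones of \<open>real ^ 8\<close>; the multiplication \<open>*\<close> that the
  library provides on this type is componentwise and unrelated.\<close>

type_synonym octonion = "real ^ 8"

definition oct_triples :: "(8 \<times> 8 \<times> 8) set" where
  "oct_triples = {(1,2,3), (1,4,5), (1,7,6), (2,4,6), (2,5,7), (3,4,7), (3,6,5)}"

definition oct_eps :: "8 \<Rightarrow> 8 \<Rightarrow> 8 \<Rightarrow> real" where
  "oct_eps i j k =
     (if {(i,j,k), (j,k,i), (k,i,j)} \<inter> oct_triples \<noteq> {} then 1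
      else if {(j,i,k), (i,k,j), (k,j,i)} \<inter> oct_triples \<noteq> {} then - 1
      else 0)"

definition oct_basis_mult :: "8 \<Rightarrow> 8 \<Rightarrow> octonion" where
  "oct_basis_mult i j =
     (if i = 0 then axis j 1
      else if j = 0 then axis i 1
      else (if i = j then - axis 0 1 else 0) + (\<Sum>k\<in>UNIV - {0}. oct_eps i j k *\<^sub>R axis k 1))"

definition oct_mult :: "octonion \<Rightarrow> octonion \<Rightarrow> octonion" where
  "oct_mult x y = (\<Sum>i\<in>UNIV. \<Sum>j\<in>UNIV. (x $ i * y $ j) *\<^sub>R oct_basis_mult i j)"

section \<open>The singular octonionic Hopf leaf decomposition\<close>

definition oct_line :: "octonion \<Rightarrow> (octonion \<times> octonion) set" where
  "oct_line m = {(x, oct_mult m x) | x. True}"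

definition oct_line_inf :: "(octonion \<times> octonion) set" where
  "oct_line_inf = {(0, x) | x. True}"

definition oct_sphere :: "real \<Rightarrow> (octonion \<times> octonion) set" where
  "oct_sphere r = {(x, y). (norm x)\<^sup>2 + (norm y)\<^sup>2 = r\<^sup>2}"

definition octonionic_Hopf_leaves :: "(octonion \<times> octonion) set set" where
  "octonionic_Hopf_leaves =
     {oct_line m \<inter> oct_sphere r | m r. r > 0} \<union>
     {oct_line_inf \<inter> oct_sphere r | r. r > 0} \<union>
     {{(0, 0)}}"

section \<open>Real analytic functions and vector fields\<close>

text \<open>Multi-indices are the functions \<open>\<alpha>\<close> from the standard basis to \<open>nat\<close>. Only used for open \<open>U\<close>;
  the values of \<open>f\<close> outside \<open>U\<close> are then irrelevant, as the radius may be shrunk.\<close>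

definition real_analytic_on ::
    "('a::euclidean_space \<Rightarrow> 'b::real_normed_vector) \<Rightarrow> 'a set \<Rightarrow> bool"
    (infix \<open>real'_analytic'_on\<close> 50) where
  "f real_analytic_on U \<longleftrightarrow>
     (\<forall>p\<in>U. \<exists>r>0. \<exists>a :: ('a \<Rightarrow> nat) \<Rightarrow> 'b. \<forall>x\<in>ball p r.
        ((\<lambda>\<alpha>. (\<Prod>b\<in>Basis. ((x - p) \<bullet> b) ^ \<alpha> b) *\<^sub>R a \<alpha>) has_sum f x) (Basis \<rightarrow>\<^sub>E UNIV))"

text \<open>A section over \<open>U\<close> is represented by its unique extension in \<open>extensional U\<close>, so that equality of
  functions is equality of sections and \<open>restrict\<close> is the restriction map of the sheaf.\<close>

definition vector_fields :: "'a::euclidean_space set \<Rightarrow> ('a \<Rightarrow> 'a) set" where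
  "vector_fields U = {X \<in> extensional U. X real_analytic_on U}"

definition lie_bracket ::
    "'a::euclidean_space set \<Rightarrow> ('a \<Rightarrow> 'a) \<Rightarrow> ('a \<Rightarrow> 'a) \<Rightarrow> ('a \<Rightarrow> 'a)" where
  "lie_bracket U X Y =
     (\<lambda>p\<in>U. frechet_derivative Y (at p) (X p) - frechet_derivative X (at p) (Y p))"

section \<open>Real analytic singular foliations\<close>

text \<open>The manifold is the whole space \<open>'a\<close>. A sheaf is given by its sets of sections; its values on sets
  that are not open play no role.\<close>

type_synonym 'a field_sheaf = "'a set \<Rightarrow> ('a \<Rightarrow> 'a) set"

definition subsheaf_of_modules :: "'a::euclidean_space field_sheaf \<Rightarrow> bool" where
  "subsheaf_of_modules F \<longleftrightarrow>
     (\<forall>U. open U \<longrightarrow> F U \<subseteq> vector_fields U) \<and>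
     (\<forall>U V X. open U \<and> open V \<and> V \<subseteq> U \<and> X \<in> F U \<longrightarrow> restrict X V \<in> F V) \<and>
     (\<forall>U X. open U \<and> X \<in> extensional U \<and>
        (\<forall>p\<in>U. \<exists>V. open V \<and> p \<in> V \<and> V \<subseteq> U \<and> restrict X V \<in> F V) \<longrightarrow> X \<in> F U) \<and>
     (\<forall>U. open U \<longrightarrow> (\<lambda>p\<in>U. 0) \<in> F U) \<and>
     (\<forall>U X Y. open U \<and> X \<in> F U \<and> Y \<in> F U \<longrightarrow> (\<lambda>p\<in>U. X p + Y p) \<in> F U) \<and>
     (\<forall>U X (f :: 'a \<Rightarrow> real). open U \<and> X \<in> F U \<and> f real_analytic_on U \<longrightarrow>
        (\<lambda>p\<in>U. f p *\<^sub>R X p) \<in> F U)"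

definition module_span ::
    "'a::euclidean_space set \<Rightarrow> ('a \<Rightarrow> 'a) set \<Rightarrow> ('a \<Rightarrow> 'a) set" where
  "module_span V G =
     {(\<lambda>p\<in>V. \<Sum>X\<in>G. f X p *\<^sub>R X p) | f :: ('a \<Rightarrow> 'a) \<Rightarrow> 'a \<Rightarrow> real.
        \<forall>X\<in>G. f X real_analytic_on V}"

definition locally_finitely_generated :: "'a::euclidean_space field_sheaf \<Rightarrow> bool" where
  "locally_finitely_generated F \<longleftrightarrow>
     (\<forall>p. \<exists>U G. open U \<and> p \<in> U \<and> finite G \<and> G \<subseteq> F U \<and>
        (\<forall>V. open V \<and> V \<subseteq> U \<longrightarrow> F V = module_span V G))"

definition involutive :: "'a::euclidean_space field_sheaf \<Rightarrow> bool" where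
  "involutive F \<longleftrightarrow> (\<forall>U X Y. open U \<and> X \<in> F U \<and> Y \<in> F U \<longrightarrow> lie_bracket U X Y \<in> F U)"

definition singular_foliation :: "'a::euclidean_space field_sheaf \<Rightarrow> bool" where
  "singular_foliation F \<longleftrightarrow>
     subsheaf_of_modules F \<and> locally_finitely_generated F \<and> involutive F"

text \<open>Nonnegative times suffice, because \<open>- X\<close> is a section whenever \<open>X\<close> is.\<close>

definition flow_step :: "'a::euclidean_space field_sheaf \<Rightarrow> 'a \<Rightarrow> 'a \<Rightarrow> bool" where
  "flow_step F p q \<longleftrightarrow>
     (\<exists>U X T \<gamma>. open U \<and> X \<in> F U \<and> 0 \<le> T \<and> \<gamma> 0 = p \<and> \<gamma> T = q \<and>
        (\<forall>t\<in>{0..T}. \<gamma> t \<in> U \<and> (\<gamma> has_vector_derivative X (\<gamma> t)) (at t within {0..T})))"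

definition leaf :: "'a::euclidean_space field_sheaf \<Rightarrow> 'a \<Rightarrow> 'a set" where
  "leaf F q = {p. (flow_step F)\<^sup>*\<^sup>* q p}"

definition leaf_decomposition :: "'a::euclidean_space field_sheaf \<Rightarrow> 'a set set" where
  "leaf_decomposition F = range (leaf F)"

section \<open>Singular Riemannian foliations\<close>

text \<open>A metric \<open>g\<close> assigns to every point \<open>p\<close> the bilinear form \<open>g p\<close> on the tangent space \<open>'a\<close>.\<close>

type_synonym 'a metric = "'a \<Rightarrow> 'a \<Rightarrow> 'a \<Rightarrow> real"

definition standard_metric :: "'a::euclidean_space metric" where
  "standard_metric p v w = v \<bullet> w"

text \<open>Christoffel symbols of the first kind, i.e. \<open>g (\<nabla>\<^bsub>u\<^esub> v, w)\<close> for constant vector fields \<open>u, v, w\<close> and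
  the Levi-Civita connection; a geodesic is a solution of the geodesic equation, paired with every \<open>w\<close>.\<close>

definition christoffel ::
    "'a::euclidean_space metric \<Rightarrow> 'a \<Rightarrow> 'a \<Rightarrow> 'a \<Rightarrow> 'a \<Rightarrow> real" where
  "christoffel g p u v w =
     (frechet_derivative (\<lambda>q. g q v w) (at p) u
      + frechet_derivative (\<lambda>q. g q u w) (at p) v
      - frechet_derivative (\<lambda>q. g q u v) (at p) w) / 2"

definition geodesic :: "'a::euclidean_space metric \<Rightarrow> real set \<Rightarrow> (real \<Rightarrow> 'a) \<Rightarrow> bool" where
  "geodesic g I \<gamma> \<longleftrightarrow>
     open I \<and> is_interval I \<and>
     (\<exists>\<gamma>' \<gamma>''. \<forall>t\<in>I.
        (\<gamma> has_vector_derivative \<gamma>' t) (at t) \<and>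
        (\<gamma>' has_vector_derivative \<gamma>'' t) (at t) \<and>
        (\<forall>w. g (\<gamma> t) (\<gamma>'' t) w + christoffel g (\<gamma> t) (\<gamma>' t) (\<gamma>' t) w = 0))"

text \<open>Velocities of curves inside \<open>L\<close>. Since leaves of singular foliations are initial submanifolds, this
  is the tangent space of the leaf \<open>L\<close> at \<open>p\<close>.\<close>

definition tangent_vectors :: "'a::euclidean_space set \<Rightarrow> 'a \<Rightarrow> 'a set" where
  "tangent_vectors L p =
     {v. \<exists>\<epsilon>>0. \<exists>c. c C1_differentiable_on {-\<epsilon><..<\<epsilon>} \<and> c ` {-\<epsilon><..<\<epsilon>} \<subseteq> L \<and>
           c 0 = p \<and> (c has_vector_derivative v) (at 0)}"

definition perpendicular_to_leaf ::
    "'a::euclidean_space metric \<Rightarrow> 'a field_sheaf \<Rightarrow> 'a \<Rightarrow> 'a \<Rightarrow> bool" where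
  "perpendicular_to_leaf g F p u \<longleftrightarrow> (\<forall>v\<in>tangent_vectors (leaf F p) p. g p u v = 0)"

definition molino_singular_riemannian ::
    "'a::euclidean_space metric \<Rightarrow> 'a field_sheaf \<Rightarrow> bool" where
  "molino_singular_riemannian g F \<longleftrightarrow>
     (\<forall>I \<gamma>. geodesic g I \<gamma> \<longrightarrow>
        (\<forall>s\<in>I. perpendicular_to_leaf g F (\<gamma> s) (vector_derivative \<gamma> (at s)) \<longrightarrow>
           (\<forall>t\<in>I. perpendicular_to_leaf g F (\<gamma> t) (vector_derivative \<gamma> (at t)))))"

definition one_forms :: "'a::euclidean_space set \<Rightarrow> ('a \<Rightarrow> 'a \<Rightarrow> real) set" where
  "one_forms U = {\<omega>. (\<forall>p\<in>U. linear (\<omega> p)) \<and> (\<forall>v. (\<lambda>p. \<omega> p v) real_analytic_on U)}"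

definition sym_product :: "('a \<Rightarrow> real) \<Rightarrow> ('a \<Rightarrow> real) \<Rightarrow> 'a \<Rightarrow> 'a \<Rightarrow> real" where
  "sym_product \<alpha> \<beta> v w = \<alpha> v * \<beta> w + \<alpha> w * \<beta> v"

definition lie_derivative_metric ::
    "('a::euclidean_space \<Rightarrow> 'a) \<Rightarrow> 'a metric \<Rightarrow> 'a metric" where
  "lie_derivative_metric X g p v w =
     frechet_derivative (\<lambda>q. g q v w) (at p) (X p)
     + g p (frechet_derivative X (at p) v) w
     + g p v (frechet_derivative X (at p) w)"

text \<open>The partially applied \<open>g p (Y i p)\<close> is the 1-form \<open>g\<^sub>\<flat> (Y i)\<close> at \<open>p\<close>.\<close>

definition module_singular_riemannian ::
    "'a::euclidean_space metric \<Rightarrow> 'a field_sheaf \<Rightarrow> bool" where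
  "module_singular_riemannian g F \<longleftrightarrow>
     (\<forall>U X. open U \<and> X \<in> F U \<longrightarrow>
        (\<exists>(N::nat) \<omega> Y. (\<forall>i<N. \<omega> i \<in> one_forms U \<and> Y i \<in> F U) \<and>
           (\<forall>p\<in>U. \<forall>v w. lie_derivative_metric X g p v w =
              (\<Sum>i<N. sym_product (\<omega> i p) (g p (Y i p)) v w))))"

end

theory Submission
  imports Defs
begin

text \<open>The leaves are the fibres of the quadratic Hopf map, so the velocities of curves in a leaf satisfy
  linear equations (vertical vectors). For the Molino property, let a straight line leave \<open>p\<close> with a
  velocity \<open>u\<close> perpendicular to the leaf. If \<open>l\<close> is the octonionic line of \<open>p\<close>, then \<open>u\<close> lies in
  \<open>\<real> p + l\<^sup>\<bottom>\<close>, and pairing vertical vectors with the reflection in \<open>l\<close> shows that \<open>u\<close> remains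
  perpendicular.

  For the second claim, suppose that all sections near the origin vanish there to order \<open>k\<close>. The module
  condition makes the Lie derivative of the metric along each section \<open>X\<close> of order \<open>k\<close> as well, so the
  part of \<open>X\<close> of degree \<open>k\<close> is a Killing field vanishing at the origin, i.e. linear and skew; it is also
  vertical. A linear vertical field is a right multiplication by an imaginary element of the nucleus of
  the octonions, hence zero, and \<open>X\<close> vanishes to order \<open>k + 1\<close>. By analyticity \<open>X\<close> is zero near the
  origin, and by local finite generation the leaves close to the origin are points, a contradiction.\<close>

section \<open>Octonion algebra\<close>

lemma UNIV_8: "{0,1,2,3,4,5,6,7} = (UNIV::8 set)"
proof (rule card_subset_eq)
  show "card {0,1,2,3,4,5,6,7::8} = card (UNIV::8 set)" by simp
qed (rule finite, rule subset_UNIV)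

lemma exhaust_8: "i = 0 \<or> i = 1 \<or> i = 2 \<or> i = 3 \<or> i = 4 \<or> i = 5 \<or> i = 6 \<or> i = (7::8)"
  using UNIV_8 by blast

lemma sum_8: "sum f (UNIV::8 set) = f 0 + f 1 + f 2 + f 3 + f 4 + f 5 + f 6 + f 7"
  unfolding UNIV_8[symmetric] by (simp add: add.assoc)

lemma oct_basis_mult_nth:
  "oct_basis_mult i j $ k =
     (if i = 0 then if k = j then 1 else 0
      else if j = 0 then if k = i then 1 else 0
      else if k = 0 then if i = j then - 1 else 0
      else oct_eps i j k)"
proof -
  have "(\<Sum>l\<in>UNIV - {0}. oct_eps i j l * axis l 1 $ k) = (if k = 0 then 0 else oct_eps i j k)"
    by (simp add: axis_def if_distrib [of "\<lambda>x. _ * x"] cong: if_cong)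
  then show ?thesis
    by (auto simp: oct_basis_mult_def axis_def)
qed

lemma oct_mult_nth_sum:
  "oct_mult x y $ k = (\<Sum>i\<in>UNIV. x $ i * (\<Sum>j\<in>UNIV. y $ j * oct_basis_mult i j $ k))"
  by (simp add: oct_mult_def sum_distrib_left mult.assoc)

lemma oct_mult_nth:
  shows "oct_mult x y $ 0 =
      x $ 0 * y $ 0 - x $ 1 * y $ 1 - x $ 2 * y $ 2 - x $ 3 * y $ 3
      - x $ 4 * y $ 4 - x $ 5 * y $ 5 - x $ 6 * y $ 6 - x $ 7 * y $ 7"
    and "oct_mult x y $ 1 =
      x $ 0 * y $ 1 + x $ 1 * y $ 0 + x $ 2 * y $ 3 - x $ 3 * y $ 2
      + x $ 4 * y $ 5 - x $ 5 * y $ 4 - x $ 6 * y $ 7 + x $ 7 * y $ 6"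
    and "oct_mult x y $ 2 =
      x $ 0 * y $ 2 - x $ 1 * y $ 3 + x $ 2 * y $ 0 + x $ 3 * y $ 1
      + x $ 4 * y $ 6 + x $ 5 * y $ 7 - x $ 6 * y $ 4 - x $ 7 * y $ 5"
    and "oct_mult x y $ 3 =
      x $ 0 * y $ 3 + x $ 1 * y $ 2 - x $ 2 * y $ 1 + x $ 3 * y $ 0
      + x $ 4 * y $ 7 - x $ 5 * y $ 6 + x $ 6 * y $ 5 - x $ 7 * y $ 4"
    and "oct_mult x y $ 4 =
      x $ 0 * y $ 4 - x $ 1 * y $ 5 - x $ 2 * y $ 6 - x $ 3 * y $ 7
      + x $ 4 * y $ 0 + x $ 5 * y $ 1 + x $ 6 * y $ 2 + x $ 7 * y $ 3"
    and "oct_mult x y $ 5 =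
      x $ 0 * y $ 5 + x $ 1 * y $ 4 - x $ 2 * y $ 7 + x $ 3 * y $ 6
      - x $ 4 * y $ 1 + x $ 5 * y $ 0 - x $ 6 * y $ 3 + x $ 7 * y $ 2"
    and "oct_mult x y $ 6 =
      x $ 0 * y $ 6 + x $ 1 * y $ 7 + x $ 2 * y $ 4 - x $ 3 * y $ 5
      - x $ 4 * y $ 2 + x $ 5 * y $ 3 + x $ 6 * y $ 0 - x $ 7 * y $ 1"
    and "oct_mult x y $ 7 =
      x $ 0 * y $ 7 - x $ 1 * y $ 6 + x $ 2 * y $ 5 + x $ 3 * y $ 4
      - x $ 4 * y $ 3 - x $ 5 * y $ 2 + x $ 6 * y $ 1 + x $ 7 * y $ 0"
  by (simp_all add: oct_mult_nth_sum sum_8 oct_basis_mult_nth oct_eps_def oct_triples_def)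

lemma norm_oct_sq:
  "(norm (x::octonion))\<^sup>2 = (x$0)\<^sup>2 + (x$1)\<^sup>2 + (x$2)\<^sup>2 + (x$3)\<^sup>2 + (x$4)\<^sup>2 + (x$5)\<^sup>2 + (x$6)\<^sup>2 + (x$7)\<^sup>2"
  unfolding power2_norm_eq_inner inner_vec_def sum_8 by (simp add: power2_eq_square)

text \<open>Degen's eight-square identity: after squaring, both sides are polynomials in the sixteen
  coordinates.\<close>

lemma norm_oct_mult: "norm (oct_mult x y) = norm x * norm y"
proof -
  have "(norm (oct_mult x y))\<^sup>2 = (norm x * norm y)\<^sup>2"
    unfolding power_mult_distrib norm_oct_sq oct_mult_nth by algebra
  then show ?thesis by simp
qed

lemma bounded_bilinear_oct_mult: "bounded_bilinear oct_mult"
proof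
  show "\<exists>K. \<forall>a b. norm (oct_mult a b) \<le> norm a * norm b * K"
    by (rule exI [of _ 1]) (simp add: norm_oct_mult)
qed (simp_all add: oct_mult_def sum.distrib scaleR_sum_right algebra_simps)

interpretation oct_mult: bounded_bilinear oct_mult
  by (rule bounded_bilinear_oct_mult)

lemma oct_eqI:
  assumes "x $ 0 = y $ 0" "x $ 1 = y $ 1" "x $ 2 = y $ 2" "x $ 3 = y $ 3"
    "x $ 4 = y $ 4" "x $ 5 = y $ 5" "x $ 6 = y $ 6" "x $ 7 = y $ 7"
  shows "x = (y::octonion)"
  unfolding vec_eq_iff
proof
  fix i
  show "x $ i = y $ i"
    using exhaust_8 [of i] by (elim disjE) (simp_all only: assms)
qed

lemma oct_mult_one_left: "oct_mult (axis 0 1) x = x"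
  and oct_mult_one_right: "oct_mult x (axis 0 1) = x"
  by (rule oct_eqI; simp add: oct_mult_nth axis_def)+

text \<open>Polarisation of the multiplicative norm in the right factor.\<close>

lemma oct_mult_inner_left: "oct_mult m x \<bullet> oct_mult m y = (m \<bullet> m) * (x \<bullet> y)"
proof -
  have "oct_mult m z \<bullet> oct_mult m z = (m \<bullet> m) * (z \<bullet> z)" for z
    using norm_oct_mult [of m z] by (simp flip: power2_norm_eq_inner add: power_mult_distrib)
  from this [of "x + y"] this [of x] this [of y] show ?thesis
    by (simp add: oct_mult.add_right inner_simps inner_commute algebra_simps)
qed

text \<open>A second polarisation, now in the left factor. It moves a factor across the inner
  product and so takes the place of conjugation.\<close>

lemma oct_mult_inner_polarized:
  "oct_mult k x \<bullet> oct_mult m y + oct_mult k y \<bullet> oct_mult m x = 2 * (k \<bullet> m) * (x \<bullet> y)"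
  using oct_mult_inner_left [of "k + m" x y] oct_mult_inner_left [of k x y] oct_mult_inner_left [of m x y]
  by (simp add: oct_mult.add_left inner_simps inner_commute algebra_simps)

lemma oct_mult_inner_right: "oct_mult k x \<bullet> oct_mult m x = (k \<bullet> m) * (x \<bullet> x)"
  using oct_mult_inner_polarized [of k x m x] by simp

lemma oct_mult_eq_0_iff: "oct_mult x y = 0 \<longleftrightarrow> x = 0 \<or> y = 0"
  using norm_oct_mult [of x y] by auto

text \<open>Division allows a vector to be tested against the products \<open>oct_mult m z\<close>
  instead of against all vectors.\<close>

lemma oct_left_divisible:
  assumes "m \<noteq> 0"
  shows "\<exists>z. oct_mult m z = y"
proof -
  have "linear (oct_mult m)"
    using oct_mult.bounded_linear_right bounded_linear.linear by blast
  moreover have "inj (oct_mult m)"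
    using assms by (simp add: linear_injective_0 [OF \<open>linear (oct_mult m)\<close>] oct_mult_eq_0_iff)
  ultimately have "surj (oct_mult m)"
    by (rule linear_injective_imp_surjective) simp
  then show ?thesis by (metis surjD)
qed

lemma oct_right_divisible:
  assumes "x \<noteq> 0"
  shows "\<exists>m. oct_mult m x = y"
proof -
  have "linear (\<lambda>m. oct_mult m x)"
    using oct_mult.bounded_linear_left bounded_linear.linear by blast
  moreover have "inj (\<lambda>m. oct_mult m x)"
    using assms by (simp add: linear_injective_0 [OF \<open>linear (\<lambda>m. oct_mult m x)\<close>] oct_mult_eq_0_iff)
  ultimately have "surj (\<lambda>m. oct_mult m x)"
    by (rule linear_injective_imp_surjective) simp
  then show ?thesis by (metis surjD)
qed

text \<open>If distinct imaginary units i, j, l lie in no common quaternion subalgebra, then i(jl) =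
  -(ij)l, so a suitable component of the associator isolates one coordinate of
  \<open>c\<close>.\<close>

lemma oct_nucleus:
  assumes "\<And>x y. oct_mult x (oct_mult y c) = oct_mult (oct_mult x y) c"
  shows "c = c $ 0 *\<^sub>R axis 0 1"
proof -
  have *: "oct_mult (axis i 1) (oct_mult (axis j 1) c) $ k = oct_mult (oct_mult (axis i 1) (axis j 1)) c $ k"
    for i j k by (simp add: assms)
  \<comment> \<open>The units 1, 2, 3 span the imaginary part of a quaternion subalgebra, so the
    pair (1, 2) detects the coordinates 4 to 7. The pair (1, 4) then reaches 2 and 3, and (2, 4)
    reaches 1.\<close>
  have "c $ 4 = 0" using * [of 1 2 7] by (simp add: oct_mult_nth axis_def)
  have "c $ 7 = 0" using * [of 1 2 4] by (simp add: oct_mult_nth axis_def)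
  have "c $ 6 = 0" using * [of 1 2 5] by (simp add: oct_mult_nth axis_def)
  have "c $ 5 = 0" using * [of 1 2 6] by (simp add: oct_mult_nth axis_def)
  have "c $ 2 = 0" using * [of 1 4 7] by (simp add: oct_mult_nth axis_def)
  have "c $ 3 = 0" using * [of 1 4 6] by (simp add: oct_mult_nth axis_def)
  have "c $ 1 = 0" using * [of 2 4 7] by (simp add: oct_mult_nth axis_def)
  then show ?thesis
    using \<open>c $ 1 = 0\<close> \<open>c $ 2 = 0\<close> \<open>c $ 3 = 0\<close> \<open>c $ 4 = 0\<close> \<open>c $ 5 = 0\<close> \<open>c $ 6 = 0\<close> \<open>c $ 7 = 0\<close>
    by (intro oct_eqI) (simp_all add: axis_def)
qed

section \<open>Homogeneous expansions of real analytic functions\<close>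

definition multi_power :: "('a::euclidean_space \<Rightarrow> nat) \<Rightarrow> 'a \<Rightarrow> real" where
  "multi_power \<alpha> v = (\<Prod>b\<in>Basis. (v \<bullet> b) ^ \<alpha> b)"

lemma multi_power_scaleR: "multi_power \<alpha> (s *\<^sub>R v) = s ^ sum \<alpha> Basis * multi_power \<alpha> v"
  by (simp add: multi_power_def power_mult_distrib prod.distrib power_sum)

lemma abs_multi_power_le: "\<bar>multi_power \<alpha> v\<bar> \<le> norm v ^ sum \<alpha> Basis"
proof -
  have "\<bar>multi_power \<alpha> v\<bar> = (\<Prod>b\<in>Basis. \<bar>v \<bullet> b\<bar> ^ \<alpha> b)"
    by (simp add: multi_power_def abs_prod power_abs)
  also have "\<dots> \<le> (\<Prod>b\<in>Basis. norm v ^ \<alpha> b)"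
    by (intro prod_mono conjI power_mono) (auto simp: Basis_le_norm)
  finally show ?thesis by (simp add: power_sum)
qed

text \<open>On the unit ball all coordinates have modulus at most 1, so telescoping the product and
  each power gives the degree as Lipschitz constant. Homogeneity rescales this to radius
  \<rho>.\<close>

lemma multi_power_diff_le:
  assumes "0 < \<rho>" "norm v \<le> \<rho>" "norm w \<le> \<rho>"
  shows "\<bar>multi_power \<alpha> v - multi_power \<alpha> w\<bar> \<le> sum \<alpha> Basis * (norm (v - w) / \<rho>) * \<rho> ^ sum \<alpha> Basis"
proof -
  have unit: "\<bar>multi_power \<alpha> x - multi_power \<alpha> y\<bar> \<le> sum \<alpha> Basis * norm (x - y)"
    if "norm x \<le> 1" "norm y \<le> 1" for x y
  proof -
    have le1: "\<bar>x \<bullet> b\<bar> \<le> 1" "\<bar>y \<bullet> b\<bar> \<le> 1" if "b \<in> Basis" for b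
      using Basis_le_norm [OF that] \<open>norm x \<le> 1\<close> \<open>norm y \<le> 1\<close> order_trans by blast+
    have "norm (multi_power \<alpha> x - multi_power \<alpha> y)
        \<le> (\<Sum>b\<in>Basis. norm ((x \<bullet> b) ^ \<alpha> b - (y \<bullet> b) ^ \<alpha> b))"
      unfolding multi_power_def
      by (rule norm_prod_diff) (simp_all add: power_abs power_le_one le1)
    also have "\<dots> \<le> (\<Sum>b\<in>Basis. \<alpha> b * norm (x - y))"
    proof (rule sum_mono)
      fix b :: 'a assume b: "b \<in> Basis"
      have "norm ((x \<bullet> b) ^ \<alpha> b - (y \<bullet> b) ^ \<alpha> b) \<le> \<alpha> b * norm (x \<bullet> b - y \<bullet> b)"
        by (rule norm_power_diff) (simp_all add: le1 b)
      also have "\<dots> \<le> \<alpha> b * norm (x - y)"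
        using Basis_le_norm [OF b, of "x - y"] by (intro mult_left_mono) (simp_all add: inner_diff_left)
      finally show "norm ((x \<bullet> b) ^ \<alpha> b - (y \<bullet> b) ^ \<alpha> b) \<le> \<alpha> b * norm (x - y)" .
    qed
    finally show ?thesis by (simp add: sum_distrib_right)
  qed
  have sc: "multi_power \<alpha> x = \<rho> ^ sum \<alpha> Basis * multi_power \<alpha> (x /\<^sub>R \<rho>)" for x
    using assms by (simp flip: multi_power_scaleR)
  have "\<bar>multi_power \<alpha> v - multi_power \<alpha> w\<bar>
      = \<rho> ^ sum \<alpha> Basis * \<bar>multi_power \<alpha> (v /\<^sub>R \<rho>) - multi_power \<alpha> (w /\<^sub>R \<rho>)\<bar>"
    using assms by (simp add: sc [of v] sc [of w] abs_mult flip: right_diff_distrib)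
  also have "\<dots> \<le> \<rho> ^ sum \<alpha> Basis * (sum \<alpha> Basis * norm (v /\<^sub>R \<rho> - w /\<^sub>R \<rho>))"
    using assms by (intro mult_left_mono unit) (simp_all add: divide_simps)
  also have "norm (v /\<^sub>R \<rho> - w /\<^sub>R \<rho>) = norm (v - w) / \<rho>"
    using assms by (simp flip: scaleR_diff_right add: divide_inverse mult.commute)
  finally show ?thesis by (simp add: mult_ac)
qed

text \<open>\<open>c n\<close> is the homogeneous part of degree \<open>n\<close> of \<open>f\<close> at \<open>p\<close>.\<close>

definition homogeneous_expansion ::
    "('a::euclidean_space \<Rightarrow> 'b::euclidean_space) \<Rightarrow> 'a \<Rightarrow> real \<Rightarrow> real \<Rightarrow> (nat \<Rightarrow> 'a \<Rightarrow> 'b) \<Rightarrow> bool" where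
  "homogeneous_expansion f p \<rho> C c \<longleftrightarrow>
     0 < \<rho> \<and>
     (\<forall>v. norm v < \<rho> \<longrightarrow> (\<lambda>n. c n v) sums f (p + v)) \<and>
     (\<forall>n s v. c n (s *\<^sub>R v) = s ^ n *\<^sub>R c n v) \<and>
     (\<forall>n v. norm (c n v) \<le> C * (norm v / \<rho>) ^ n) \<and>
     (\<forall>n v w. norm v \<le> \<rho> \<longrightarrow> norm w \<le> \<rho> \<longrightarrow> norm (c n v - c n w) \<le> C * (n * (norm (v - w) / \<rho>))) \<and>
     linear (c 1)"

text \<open>Unconditional summability is absolute for real series, hence componentwise in finite
  dimension.\<close>

lemma abs_summable_on_euclidean:
  fixes f :: "'i \<Rightarrow> 'b::euclidean_space"
  assumes "f summable_on A"
  shows "(\<lambda>x. norm (f x)) summable_on A"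
proof -
  have component: "(\<lambda>x. \<bar>f x \<bullet> b\<bar>) summable_on A" for b
  proof -
    have "(\<lambda>x. f x \<bullet> b) summable_on A"
      using summable_on_bounded_linear [OF bounded_linear_inner_left assms] by (simp add: o_def)
    then show ?thesis
      using summable_on_iff_abs_summable_on_real by force
  qed
  have "(\<lambda>x. \<Sum>b\<in>B. \<bar>f x \<bullet> b\<bar>) summable_on A" if "finite B" for B
    using that by (induction B rule: finite_induct) (simp_all add: component summable_on_add)
  from this [OF finite_Basis] show ?thesis
    by (rule summable_on_comparison_test) (auto intro: norm_le_l1)
qed

text \<open>Differentiating along the ray through \<open>v\<close> identifies \<open>c v\<close>
  with the derivative of \<open>c\<close> at 0 applied to \<open>v\<close>.\<close>

lemma homogeneous_degree_1_linear:
  fixes c :: "'a::euclidean_space \<Rightarrow> 'b::euclidean_space"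
  assumes "c differentiable (at 0)" and "\<And>s v. c (s *\<^sub>R v) = s *\<^sub>R c v"
  shows "linear c"
proof -
  obtain D where D: "(c has_derivative D) (at 0)"
    using assms(1) by (auto simp: differentiable_def)
  have "c v = D v" for v
  proof -
    have "((\<lambda>s. s *\<^sub>R v) has_derivative (\<lambda>s. s *\<^sub>R v)) (at (0::real))"
      by (auto intro!: derivative_eq_intros)
    then have "((\<lambda>s. c (s *\<^sub>R v)) has_derivative (\<lambda>s. D (s *\<^sub>R v))) (at 0)"
      by (rule has_derivative_compose) (use D in simp)
    moreover have "((\<lambda>s. s *\<^sub>R c v) has_derivative (\<lambda>s. s *\<^sub>R c v)) (at (0::real))"
      by (auto intro!: derivative_eq_intros)
    ultimately have "(\<lambda>s. D (s *\<^sub>R v)) = (\<lambda>s. s *\<^sub>R c v)"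
      by (simp add: assms(2) has_derivative_unique)
    then show ?thesis by (metis scaleR_one)
  qed
  then show ?thesis
    using D by (metis ext has_derivative_linear)
qed

text \<open>The power series is regrouped by total degree. All estimates come from its absolute
  convergence at the single point whose coordinates all equal \<rho>.\<close>

lemma real_analytic_expansion:
  fixes f :: "'a::euclidean_space \<Rightarrow> 'b::euclidean_space"
  assumes "f real_analytic_on U" "p \<in> U"
  obtains \<rho> C c where "homogeneous_expansion f p \<rho> C c"
proof -
  define I where "I = (Basis \<rightarrow>\<^sub>E (UNIV::nat set) :: ('a \<Rightarrow> nat) set)"
  obtain r a where r: "r > 0" and a: "\<And>x. x \<in> ball p r \<Longrightarrow>
        ((\<lambda>\<alpha>. multi_power \<alpha> (x - p) *\<^sub>R a \<alpha>) has_sum f x) I"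
    using assms unfolding real_analytic_on_def multi_power_def I_def by metis
  \<comment> \<open>The vector with all coordinates \<rho> has norm at most
    \<open>\<rho> * DIM('a)\<close>, which this choice keeps below \<open>r\<close>.\<close>
  define \<rho> where "\<rho> = r / (2 * DIM('a))"
  have \<rho>: "0 < \<rho>" "\<rho> < r" "\<rho> * DIM('a) < r"
    proof -
    have "1 \<le> real DIM('a)" using DIM_ge_Suc0 [where 'a='a] by simp
    then have "1 < real DIM('a) * 2" by linarith
    with r show "0 < \<rho>" "\<rho> < r" "\<rho> * DIM('a) < r" by (simp_all add: \<rho>_def field_simps)
  qed
  define deg where "deg = (\<lambda>\<alpha>::'a \<Rightarrow> nat. sum \<alpha> Basis)"
  define A where "A n = {\<alpha>\<in>I. deg \<alpha> = n}" for n
  define c where "c n v = (\<Sum>\<alpha>\<in>A n. multi_power \<alpha> v *\<^sub>R a \<alpha>)" for n v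
  define S where "S = (\<Sum>\<^sub>\<infinity>\<alpha>\<in>I. \<rho> ^ deg \<alpha> * norm (a \<alpha>))"
  have finA: "finite (A n)" for n
  proof (rule finite_subset)
    show "A n \<subseteq> Basis \<rightarrow>\<^sub>E {..n}"
      by (auto simp: A_def I_def deg_def PiE_iff extensional_def intro: member_le_sum)
  qed (simp add: finite_PiE)
  have summ: "(\<lambda>\<alpha>. \<rho> ^ deg \<alpha> * norm (a \<alpha>)) summable_on I"
  proof -
    \<comment> \<open>At this vector every monomial takes the value \<rho> to the power of its
      degree.\<close>
    define v where "v = (\<Sum>b\<in>Basis. \<rho> *\<^sub>R (b::'a))"
    have vb: "v \<bullet> b = \<rho>" if "b \<in> Basis" for b
      using that by (simp add: v_def inner_sum_left inner_Basis if_distrib cong: if_cong)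
    have "norm v \<le> (\<Sum>b\<in>(Basis::'a set). \<rho>)"
      unfolding v_def using \<rho> by (intro sum_norm_le) simp
    also have "\<dots> < r" using \<rho> by (simp add: mult.commute)
    finally have "p + v \<in> ball p r" by (simp add: dist_norm)
    from a [OF this] have "(\<lambda>\<alpha>. multi_power \<alpha> v *\<^sub>R a \<alpha>) summable_on I"
      by (auto simp: summable_on_def)
    then have "(\<lambda>\<alpha>. norm (multi_power \<alpha> v *\<^sub>R a \<alpha>)) summable_on I"
      by (rule abs_summable_on_euclidean)
    moreover have "multi_power \<alpha> v = \<rho> ^ deg \<alpha>" for \<alpha>
      by (simp add: multi_power_def vb deg_def power_sum)
    ultimately show ?thesis using \<rho> by simp
  qed
  have S: "(\<Sum>\<alpha>\<in>A n. \<rho> ^ n * norm (a \<alpha>)) \<le> S" for n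
  proof -
    have "(\<Sum>\<alpha>\<in>A n. \<rho> ^ deg \<alpha> * norm (a \<alpha>)) \<le> S"
      unfolding S_def by (rule finite_sum_le_infsum [OF summ finA]) (use \<rho> in \<open>auto simp: A_def\<close>)
    then show ?thesis by (simp add: A_def)
  qed
  have sums: "(\<lambda>n. c n v) sums f (p + v)" if "norm v < \<rho>" for v
  proof -
    have "((\<lambda>\<alpha>. multi_power \<alpha> v *\<^sub>R a \<alpha>) has_sum f (p + v)) I"
      using a [of "p + v"] that \<rho> by (simp add: dist_norm)
    \<comment> \<open>The finite sets \<open>A n\<close> partition the multi-indices, so the
      unordered sum can be taken degree by degree.\<close>
    moreover have "I = snd ` Sigma UNIV A" "inj_on snd (Sigma UNIV A)"
      by (auto simp: A_def image_iff inj_on_def)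
    ultimately have "((\<lambda>\<alpha>. multi_power (snd \<alpha>) v *\<^sub>R a (snd \<alpha>)) has_sum f (p + v)) (Sigma UNIV A)"
      by (simp add: has_sum_reindex o_def)
    then have "((\<lambda>n. c n v) has_sum f (p + v)) UNIV"
      by (rule has_sum_Sigma [rotated]) (simp_all add: uniformly_continuous_add c_def finA)
    then show ?thesis by (rule has_sum_imp_sums)
  qed
  have hom: "c n (s *\<^sub>R v) = s ^ n *\<^sub>R c n v" for n s v
    by (simp add: c_def A_def deg_def multi_power_scaleR scaleR_sum_right)
  have bound: "norm (c n v) \<le> S * (norm v / \<rho>) ^ n" for n v
  proof -
    have "norm (c n v) \<le> (\<Sum>\<alpha>\<in>A n. norm v ^ n * norm (a \<alpha>))"
      unfolding c_def
    proof (rule sum_norm_le)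
      fix \<alpha> assume "\<alpha> \<in> A n"
      then show "norm (multi_power \<alpha> v *\<^sub>R a \<alpha>) \<le> norm v ^ n * norm (a \<alpha>)"
        using abs_multi_power_le [of \<alpha> v] by (auto simp: A_def deg_def intro!: mult_right_mono)
    qed
    also have "\<dots> = (norm v / \<rho>) ^ n * (\<Sum>\<alpha>\<in>A n. \<rho> ^ n * norm (a \<alpha>))"
      using \<rho> by (simp add: sum_distrib_left power_divide)
    also have "\<dots> \<le> (norm v / \<rho>) ^ n * S"
      using \<rho> by (intro mult_left_mono S) simp
    finally show ?thesis by (simp add: mult.commute)
  qed
  have lip: "norm (c n v - c n w) \<le> S * (n * (norm (v - w) / \<rho>))" if "norm v \<le> \<rho>" "norm w \<le> \<rho>" for n v w
  proof -
    have "norm (c n v - c n w) \<le> (\<Sum>\<alpha>\<in>A n. n * (norm (v - w) / \<rho>) * \<rho> ^ n * norm (a \<alpha>))"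
      unfolding c_def sum_subtractf [symmetric] scaleR_diff_left [symmetric]
    proof (rule sum_norm_le)
      fix \<alpha> assume "\<alpha> \<in> A n"
      then show "norm ((multi_power \<alpha> v - multi_power \<alpha> w) *\<^sub>R a \<alpha>)
          \<le> n * (norm (v - w) / \<rho>) * \<rho> ^ n * norm (a \<alpha>)"
        using multi_power_diff_le [OF \<rho>(1) that, of \<alpha>]
        unfolding A_def deg_def norm_scaleR real_norm_def by (intro mult_right_mono) auto
    qed
    also have "\<dots> = n * (norm (v - w) / \<rho>) * (\<Sum>\<alpha>\<in>A n. \<rho> ^ n * norm (a \<alpha>))"
      by (simp add: sum_distrib_left mult.assoc)
    also have "\<dots> \<le> n * (norm (v - w) / \<rho>) * S"
      using \<rho> by (intro mult_left_mono S) simp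
    finally show ?thesis by (simp add: mult_ac)
  qed
  have "linear (c 1)"
  proof (rule homogeneous_degree_1_linear)
    have "multi_power \<alpha> differentiable (at 0)" for \<alpha> :: "'a \<Rightarrow> nat"
    proof -
      have "((\<lambda>v. v \<bullet> b) has_derivative (\<lambda>v. v \<bullet> b)) (at 0)" for b :: 'a
        by (auto intro!: derivative_eq_intros)
      from has_derivative_power [OF this]
      have "(\<lambda>v. (v \<bullet> b) ^ m) differentiable (at 0)" for b :: 'a and m
        unfolding differentiable_def by blast
      then obtain D where "\<And>b m. ((\<lambda>v. (v \<bullet> b) ^ m) has_derivative D b m) (at (0::'a))"
        unfolding differentiable_def by metis
      then have "((\<lambda>v. \<Prod>b\<in>Basis. (v \<bullet> b) ^ \<alpha> b) has_derivative
          (\<lambda>y. \<Sum>i\<in>Basis. D i (\<alpha> i) y * (\<Prod>j\<in>Basis - {i}. (0 \<bullet> j) ^ \<alpha> j))) (at (0::'a))"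
        by (intro has_derivative_prod)
      then show ?thesis
        unfolding multi_power_def differentiable_def by blast
    qed
    then show "c 1 differentiable (at 0)"
      unfolding c_def using finA by (intro differentiable_sum differentiable_scaleR) auto
  qed (use hom [of 1] in simp)
  then have "homogeneous_expansion f p \<rho> S c"
    using \<rho> sums hom bound lip unfolding homogeneous_expansion_def by blast
  then show ?thesis by (rule that)
qed

section \<open>Remainder, derivative, Lipschitz bound and leading term of an expansion\<close>

lemma homogeneous_expansionD:
  assumes "homogeneous_expansion f p \<rho> C c"
  shows "0 < \<rho>" and "0 \<le> C"
    and "norm v < \<rho> \<Longrightarrow> (\<lambda>n. c n v) sums f (p + v)"
    and "c n (s *\<^sub>R v) = s ^ n *\<^sub>R c n v"
    and "norm (c n v) \<le> C * (norm v / \<rho>) ^ n"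
    and "\<lbrakk>norm v \<le> \<rho>; norm w \<le> \<rho>\<rbrakk> \<Longrightarrow> norm (c n v - c n w) \<le> C * (n * (norm (v - w) / \<rho>))"
    and "linear (c 1)"
proof -
  have "norm (c 0 0) \<le> C * (norm (0::'a) / \<rho>) ^ 0"
    using assms unfolding homogeneous_expansion_def by blast
  then show "0 \<le> C" using order_trans [OF norm_ge_zero] by simp
qed (use assms in \<open>unfold homogeneous_expansion_def, blast+\<close>)

text \<open>Within half the radius the tail is dominated by a geometric series of ratio 1/2, whose
  sum is the factor 2.\<close>

lemma expansion_tail:
  fixes f :: "'a::euclidean_space \<Rightarrow> 'b::euclidean_space"
  assumes e: "homogeneous_expansion f p \<rho> C c" and v: "norm v \<le> \<rho> / 2"
  shows "norm (f (p + v) - (\<Sum>n<k. c n v)) \<le> 2 * C * (norm v / \<rho>) ^ k"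
proof -
  note \<rho> = homogeneous_expansionD(1) [OF e] and C = homogeneous_expansionD(2) [OF e]
    and bd = homogeneous_expansionD(5) [OF e, of _ v]
  have sums: "(\<lambda>n. c n v) sums f (p + v)"
    using v \<rho> by (intro homogeneous_expansionD(3) [OF e]) simp
  define q where "q = norm v / \<rho>"
  have q: "0 \<le> q" "q \<le> 1/2" using v \<rho> by (simp_all add: q_def field_simps)
  have tail: "(\<lambda>n. c (n + k) v) sums (f (p + v) - (\<Sum>n<k. c n v))"
    using sums by (rule sums_split_initial_segment)
  have geo: "(\<lambda>n. C * q ^ k * (1/2) ^ n) sums (C * q ^ k * 2)"
    using geometric_sums [of "1/2::real"] by (intro sums_mult) simp
  have "norm (c (n + k) v) \<le> C * q ^ k * (1/2) ^ n" for n
  proof -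
    have "norm (c (n + k) v) \<le> C * q ^ k * q ^ n"
      using bd [of "n + k"] by (simp add: q_def power_add mult_ac)
    also have "\<dots> \<le> C * q ^ k * (1/2) ^ n"
      using q C by (intro mult_left_mono power_mono) simp_all
    finally show ?thesis .
  qed
  then have "norm (\<Sum>n. c (n + k) v) \<le> (\<Sum>n. C * q ^ k * (1/2) ^ n)"
    using sums_summable [OF geo] by (intro norm_suminf_le) auto
  then show ?thesis
    using sums_unique [OF tail] sums_unique [OF geo] by (simp add: q_def mult_ac)
qed

text \<open>The degree 0 part is the constant \<open>f p\<close> and the remainder from degree 2 on
  is quadratic, so the linear part is the derivative.\<close>

lemma expansion_has_derivative:
  fixes f :: "'a::euclidean_space \<Rightarrow> 'b::euclidean_space"
  assumes e: "homogeneous_expansion f p \<rho> C c"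
  shows "(f has_derivative c 1) (at p)"
proof -
  note \<rho> = homogeneous_expansionD(1) [OF e] and c_hom = homogeneous_expansionD(4) [OF e]
    and lin = homogeneous_expansionD(7) [OF e]
  have sums: "(\<lambda>n. c n 0) sums f p"
    using homogeneous_expansionD(3) [OF e, of 0] \<rho> by simp
  have "c 0 v = f p" for v
  proof -
    \<comment> \<open>Homogeneity with scalar 0: because 0 ^ 0 = 1, degree 0 gives
      \<open>c 0 0 = c 0 v\<close>, while all higher parts vanish at 0.\<close>
    have "(\<lambda>n. c n 0) = (\<lambda>n. if n = 0 then c 0 v else 0)"
      using c_hom [of _ 0 v] by (auto simp: fun_eq_iff)
    with sums have "(\<lambda>n. if n = 0 then c 0 v else 0) sums f p" by simp
    then show ?thesis using sums_single [of 0 "\<lambda>_. c 0 v"] sums_unique2 by blast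
  qed
  then have rem: "norm (f (p + v) - f p - c 1 v) \<le> 2 * C * (norm v / \<rho>)\<^sup>2" if "norm v \<le> \<rho> / 2" for v
    using expansion_tail [OF e that, of 2] by (simp add: numeral_2_eq_2 algebra_simps)
  have "((\<lambda>v. norm (f (p + v) - f p - c 1 v) / norm v) \<longlongrightarrow> 0) (at 0)"
  proof (rule tendsto_sandwich [OF _ _ tendsto_const])
    show "\<forall>\<^sub>F v in at 0. norm (f (p + v) - f p - c 1 v) / norm v \<le> 2 * C / \<rho>\<^sup>2 * norm v"
      unfolding eventually_at using \<rho> rem
      by (intro exI [of _ "\<rho> / 2"]) (auto simp: dist_norm field_simps power2_eq_square)
    show "((\<lambda>v. 2 * C / \<rho>\<^sup>2 * norm v) \<longlongrightarrow> 0) (at (0::'a))"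
      by (intro tendsto_mult_right_zero tendsto_norm_zero tendsto_ident_at)
  qed simp
  then show ?thesis
    using lin by (simp add: has_derivative_at linear_conv_bounded_linear)
qed

text \<open>The part of degree \<open>n\<close> has a Lipschitz bound proportional to
  \<open>n\<close> on the ball of radius \<rho>. Scaling up from a quarter of the radius gains
  (1/4)^n, which absorbs \<open>n\<close> since n < 2^n. The bound feeds the construction of
  integral curves.\<close>

lemma expansion_lipschitz:
  fixes f :: "'a::euclidean_space \<Rightarrow> 'b::euclidean_space"
  assumes e: "homogeneous_expansion f p \<rho> C c"
    and v: "norm v \<le> \<rho> / 4" and w: "norm w \<le> \<rho> / 4"
  shows "norm (f (p + v) - f (p + w)) \<le> 8 * C / \<rho> * norm (v - w)"
proof -
  note \<rho> = homogeneous_expansionD(1) [OF e] and C = homogeneous_expansionD(2) [OF e]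
  have sv: "(\<lambda>n. c n v) sums f (p + v)" and sw: "(\<lambda>n. c n w) sums f (p + w)"
    using v w \<rho> by (auto intro: homogeneous_expansionD(3) [OF e])
  define B where "B = 4 * C / \<rho> * norm (v - w)"
  have B: "0 \<le> B" using \<rho> C by (simp add: B_def)
  have geo: "(\<lambda>n. B * (1/2) ^ n) sums (B * 2)"
    using geometric_sums [of "1/2::real"] by (intro sums_mult) simp
  have "norm (c n v - c n w) \<le> B * (1/2) ^ n" for n
  proof -
    have sc: "c n x = (1/4) ^ n *\<^sub>R c n (4 *\<^sub>R x)" for x
    proof -
      have "c n (4 *\<^sub>R x) = 4 ^ n *\<^sub>R c n x"
        by (rule homogeneous_expansionD(4) [OF e])
      then show ?thesis by (simp add: power_one_over)
    qed
    have "norm (c n (4 *\<^sub>R v) - c n (4 *\<^sub>R w)) \<le> C * (n * (norm (4 *\<^sub>R v - 4 *\<^sub>R w) / \<rho>))"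
      using v w by (intro homogeneous_expansionD(6) [OF e]) simp_all
    also have "\<dots> = n * B"
      by (simp add: B_def mult_ac flip: scaleR_diff_right)
    finally have "(1/4) ^ n * norm (c n (4 *\<^sub>R v) - c n (4 *\<^sub>R w)) \<le> (1/4) ^ n * (n * B)"
      by (rule mult_left_mono) simp
    moreover have "norm (c n v - c n w) = (1/4) ^ n * norm (c n (4 *\<^sub>R v) - c n (4 *\<^sub>R w))"
      by (simp add: sc [of v] sc [of w] flip: scaleR_diff_right)
    moreover have "(1/4) ^ n * (n * B) \<le> B * (1/2) ^ n"
    proof -
      have "(1/4) ^ n * real n \<le> (1/4) ^ n * 2 ^ n"
        by (intro mult_left_mono) (simp_all add: less_imp_le of_nat_less_two_power)
      also have "\<dots> = (1/2) ^ n" by (simp flip: power_mult_distrib)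
      finally show ?thesis using mult_right_mono [OF _ B] by (fastforce simp: mult_ac)
    qed
    ultimately show ?thesis by linarith
  qed
  then have "norm (\<Sum>n. c n v - c n w) \<le> (\<Sum>n. B * (1/2) ^ n)"
    using sums_summable [OF geo] by (intro norm_suminf_le) auto
  then show ?thesis
    using sums_unique [OF sums_diff [OF sv sw]] sums_unique [OF geo] by (simp add: B_def mult_ac)
qed

text \<open>The remainder after degree \<open>k\<close> is of order s^(k+1). Through this limit,
  closed conditions on a field pass to its lowest homogeneous part.\<close>

lemma expansion_leading_term:
  fixes f :: "'a::euclidean_space \<Rightarrow> 'b::euclidean_space"
  assumes e: "homogeneous_expansion f 0 \<rho> C c" and vanish: "\<And>j v. j < k \<Longrightarrow> c j v = 0"
  shows "((\<lambda>s. f (s *\<^sub>R v) /\<^sub>R s ^ k) \<longlongrightarrow> c k v) (at_right 0)"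
proof -
  note \<rho> = homogeneous_expansionD(1) [OF e] and hom = homogeneous_expansionD(4) [OF e]
  have "((\<lambda>s. f (s *\<^sub>R v) /\<^sub>R s ^ k - c k v) \<longlongrightarrow> 0) (at_right 0)"
  proof (rule Lim_null_comparison)
    \<comment> \<open>The bound on \<open>s\<close> puts \<open>s *\<^sub>R v\<close> into the ball
      of radius \<rho> / 2; the summand 2 keeps the denominator positive for
      \<open>v = 0\<close>.\<close>
    have "norm (f (s *\<^sub>R v) /\<^sub>R s ^ k - c k v) \<le> 2 * C * (norm v / \<rho>) ^ Suc k * s"
      if s: "0 < s" "s < \<rho> / (2 * norm v + 2)" for s
    proof -
      have "s * (2 * norm v + 2) \<le> \<rho>" using s by (simp add: pos_less_divide_eq add_nonneg_pos less_imp_le)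
      then have "norm (s *\<^sub>R v) \<le> \<rho> / 2" using s by (simp add: algebra_simps)
      from expansion_tail [OF e this, of "Suc k"]
      have *: "norm (f (s *\<^sub>R v) - s ^ k *\<^sub>R c k v) \<le> 2 * C * (s * norm v / \<rho>) ^ Suc k"
        using s by (simp add: vanish hom)
      have "f (s *\<^sub>R v) /\<^sub>R s ^ k - c k v = (f (s *\<^sub>R v) - s ^ k *\<^sub>R c k v) /\<^sub>R s ^ k"
        using s by (simp add: scaleR_diff_right)
      then have "norm (f (s *\<^sub>R v) /\<^sub>R s ^ k - c k v) = norm (f (s *\<^sub>R v) - s ^ k *\<^sub>R c k v) / s ^ k"
        using s by (simp add: divide_inverse mult.commute)
      also have "\<dots> \<le> 2 * C * (s * norm v / \<rho>) ^ Suc k / s ^ k"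
        using s by (intro divide_right_mono *) simp
      also have "\<dots> = 2 * C * (norm v / \<rho>) ^ Suc k * s"
        using s \<rho> by (simp add: power_divide power_mult_distrib)
      finally show ?thesis .
    qed
    moreover have "0 < \<rho> / (2 * norm v + 2)" using \<rho> by (simp add: add_nonneg_pos)
    ultimately show "\<forall>\<^sub>F s in at_right 0. norm (f (s *\<^sub>R v) /\<^sub>R s ^ k - c k v) \<le> 2 * C * (norm v / \<rho>) ^ Suc k * s"
      unfolding eventually_at_right_field by blast
  qed (intro tendsto_mult_right_zero tendsto_ident_at)
  then show ?thesis by (simp add: LIM_zero_iff)
qed

section \<open>Existence of integral curves\<close>

text \<open>Picard-Lindeloef by Banach's fixed point theorem. The time interval is one-sided, as in
  \<open>flow_step\<close>.\<close>

lemma local_flow_exists: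
  fixes X :: "'a::euclidean_space \<Rightarrow> 'a"
  assumes r: "0 < r" and lip: "\<And>x y. \<lbrakk>x \<in> cball p r; y \<in> cball p r\<rbrakk> \<Longrightarrow> norm (X x - X y) \<le> K * norm (x - y)"
  obtains T \<gamma> where "0 < T" "\<gamma> 0 = p" "\<And>t. t \<in> {0..T} \<Longrightarrow> \<gamma> t \<in> cball p r"
    "\<And>t. t \<in> {0..T} \<Longrightarrow> (\<gamma> has_vector_derivative X (\<gamma> t)) (at t within {0..T})"
proof -
  define L where "L = \<bar>K\<bar> + 1"
  \<comment> \<open>Extended to the whole space by the nearest-point projection, the field is globally Lipschitz and
    bounded, so that the Picard operator \<open>\<Phi>\<close> acts on all bounded continuous curves.\<close>
  define Y where "Y = (\<lambda>x. X (closest_point (cball p r) x))"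
  have cp: "closest_point (cball p r) x \<in> cball p r" for x
    using r by (intro closest_point_in_set) auto
  have L: "0 < L" by (simp add: L_def)
  have Y_lip: "norm (Y x - Y y) \<le> L * norm (x - y)" for x y
  proof -
    have "norm (Y x - Y y) \<le> K * norm (closest_point (cball p r) x - closest_point (cball p r) y)"
      unfolding Y_def by (intro lip cp)
    also have "\<dots> \<le> L * norm (closest_point (cball p r) x - closest_point (cball p r) y)"
      by (intro mult_right_mono) (auto simp: L_def)
    also have "\<dots> \<le> L * norm (x - y)"
      using closest_point_lipschitz [of "cball p r" x y] r L
      by (intro mult_left_mono) (auto simp: dist_norm)
    finally show ?thesis .
  qed
  define M where "M = norm (X p) + L * r"
  have M: "0 \<le> M" using L r by (simp add: M_def)
  have Y_bound: "norm (Y x) \<le> M" for x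
  proof -
    have "norm (Y x - X p) \<le> K * norm (closest_point (cball p r) x - p)"
      unfolding Y_def using r by (intro lip cp) auto
    also have "\<dots> \<le> L * r"
      using cp [of x] L by (intro mult_mono) (auto simp: L_def dist_norm norm_minus_commute)
    finally show ?thesis
      unfolding M_def using norm_triangle_sub [of "Y x" "X p"] by linarith
  qed
  have "continuous_on UNIV Y"
  proof (rule lipschitz_on_continuous_on [of L])
    show "L-lipschitz_on UNIV Y" using Y_lip L by (auto simp: lipschitz_on_def dist_norm)
  qed
  then have cont: "continuous_on A (\<lambda>s. Y (f s))" if "continuous_on A f" for A :: "real set" and f
    using continuous_on_compose2 that by blast
  \<comment> \<open>The first bound makes the Picard operator a contraction with factor 1/2, the
    second keeps its curves in the ball; \<open>M + 1\<close> is positive even if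
    \<open>M = 0\<close>.\<close>
  define T where "T = min (1 / (2 * L)) (r / (M + 1))"
  have T: "0 < T" "T * L \<le> 1/2" "T * M \<le> r"
  proof -
    show "0 < T" using L M r by (simp add: T_def)
    have "T * L \<le> 1 / (2 * L) * L" using L by (intro mult_right_mono) (simp_all add: T_def)
    then show "T * L \<le> 1/2" using L by simp
    have "T * M \<le> r / (M + 1) * M" using M by (intro mult_right_mono) (simp_all add: T_def)
    also have "\<dots> \<le> r" using M r by (simp add: field_simps)
    finally show "T * M \<le> r" .
  qed
  \<comment> \<open>Clamping time to [0, T] extends the curves constantly to the whole line, where
    they are elements of the complete space of bounded continuous functions.\<close>
  define k where "k t = max 0 (min T t)" for t
  have k: "k t \<in> {0..T}" for t using T by (auto simp: k_def)
  define \<Phi> where "\<Phi> f t = p + integral {0..k t} (\<lambda>s. Y (f s))" for f t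
  have \<Phi>_cont: "continuous_on UNIV (\<Phi> f)" if "continuous_on UNIV f" for f
  proof -
    have "continuous_on {0..T} (\<lambda>t. integral {0..t} (\<lambda>s. Y (f s)))"
      by (intro indefinite_integral_continuous_1 integrable_continuous_interval cont
          continuous_on_subset [OF that]) simp
    moreover have "continuous_on UNIV k" unfolding k_def by (intro continuous_intros)
    ultimately have "continuous_on UNIV (\<lambda>t. integral {0..k t} (\<lambda>s. Y (f s)))"
      by (rule continuous_on_compose2) (use k in auto)
    then show ?thesis unfolding \<Phi>_def by (intro continuous_intros)
  qed
  have \<Phi>_near: "norm (\<Phi> f t - p) \<le> r" if "continuous_on UNIV f" for f t
  proof -
    have "norm (integral {0..k t} (\<lambda>s. Y (f s))) \<le> M * (k t - 0)"
      using k [of t] Y_bound by (intro integral_bound cont continuous_on_subset [OF that]) auto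
    also have "\<dots> \<le> M * T" using k [of t] M by (intro mult_left_mono) auto
    finally show ?thesis using T by (simp add: \<Phi>_def mult.commute)
  qed
  have \<Phi>_bcontfun: "\<Phi> f \<in> bcontfun" if "continuous_on UNIV f" for f
  proof (rule bcontfun_normI)
    show "norm (\<Phi> f t) \<le> norm p + r" for t
      using \<Phi>_near [OF that, of t] norm_triangle_sub [of "\<Phi> f t" p] by linarith
  qed (rule \<Phi>_cont [OF that])
  define F where "F f = Bcontfun (\<Phi> (apply_bcontfun f))" for f
  have F_apply: "apply_bcontfun (F f) = \<Phi> (apply_bcontfun f)" for f
    unfolding F_def by (intro Bcontfun_inverse \<Phi>_bcontfun) simp
  have "dist (F f) (F g) \<le> 1/2 * dist f g" for f g
  proof (rule dist_bound)
    fix t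
    have fg: "continuous_on {0..k t} (\<lambda>s. Y (apply_bcontfun h s))" for h
      by (intro cont) simp
    have "norm (integral {0..k t} (\<lambda>s. Y (apply_bcontfun f s) - Y (apply_bcontfun g s)))
        \<le> L * dist f g * (k t - 0)"
    proof (rule integral_bound)
      fix s
      have "norm (Y (apply_bcontfun f s) - Y (apply_bcontfun g s)) \<le> L * norm (apply_bcontfun f s - apply_bcontfun g s)"
        by (rule Y_lip)
      also have "\<dots> \<le> L * dist f g"
        using L dist_bounded [of f s g] by (intro mult_left_mono) (auto simp: dist_norm)
      finally show "norm (Y (apply_bcontfun f s) - Y (apply_bcontfun g s)) \<le> L * dist f g" .
    qed (use k in \<open>auto intro!: continuous_on_diff fg\<close>)
    also have "\<dots> \<le> L * dist f g * T"
      using k [of t] L by (intro mult_left_mono) auto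
    also have "\<dots> \<le> 1/2 * dist f g"
      using mult_right_mono [OF T(2), of "dist f g"] by (simp add: mult_ac)
    finally show "dist (apply_bcontfun (F f) t) (apply_bcontfun (F g) t) \<le> 1/2 * dist f g"
      by (simp add: F_apply \<Phi>_def dist_norm integral_diff [OF integrable_continuous_interval [OF fg] integrable_continuous_interval [OF fg]])
  qed
  then obtain f where f: "F f = f"
    using banach_fix_type [of "1/2" F] by auto
  define \<gamma> where "\<gamma> = apply_bcontfun f"
  have \<gamma>_cont: "continuous_on A \<gamma>" for A by (simp add: \<gamma>_def)
  have \<gamma>: "\<gamma> = \<Phi> \<gamma>" using F_apply [of f] f by (simp add: \<gamma>_def)
  have mem: "\<gamma> t \<in> cball p r" for t
    using \<Phi>_near [OF \<gamma>_cont, of t] by (simp flip: \<gamma> add: dist_norm norm_minus_commute)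
  have "(\<gamma> has_vector_derivative X (\<gamma> t)) (at t within {0..T})" if t: "t \<in> {0..T}" for t
  proof -
    have "((\<lambda>t. p + integral {0..t} (\<lambda>s. Y (\<gamma> s))) has_vector_derivative 0 + Y (\<gamma> t)) (at t within {0..T})"
      by (intro has_vector_derivative_add has_vector_derivative_const
          integral_has_vector_derivative cont \<gamma>_cont t)
    moreover have "Y (\<gamma> t) = X (\<gamma> t)"
      using mem by (simp add: Y_def closest_point_self)
    moreover have "\<gamma> t = p + integral {0..t} (\<lambda>s. Y (\<gamma> s))" if "t \<in> {0..T}" for t
      using that by (subst \<gamma>) (simp add: \<Phi>_def k_def)
    ultimately show ?thesis
      using has_vector_derivative_transform [OF t, of \<gamma>] by simp
  qed
  moreover have "\<gamma> 0 = p" using T by (subst \<gamma>) (simp add: \<Phi>_def k_def)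
  ultimately show ?thesis using T mem by (intro that [of T \<gamma>]) auto
qed

section \<open>Geometry of the Hopf leaves\<close>

text \<open>The kernel of the differential at \<open>q\<close> of the Hopf map \<open>(x, y) \<mapsto> (|x|\<^sup>2, |y|\<^sup>2, y x\<^sup>*)\<close>, whose fibres are
  the leaves; pairing the last component with \<open>k\<close> avoids the conjugation.\<close>

definition hopf_vertical :: "octonion \<times> octonion \<Rightarrow> octonion \<times> octonion \<Rightarrow> bool" where
  "hopf_vertical q v \<longleftrightarrow> fst q \<bullet> fst v = 0 \<and> snd q \<bullet> snd v = 0 \<and>
     (\<forall>k. oct_mult k (fst v) \<bullet> snd q + oct_mult k (fst q) \<bullet> snd v = 0)"

lemma hopf_vertical_inner: "hopf_vertical q v \<Longrightarrow> q \<bullet> v = 0"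
  by (simp add: hopf_vertical_def inner_prod_def)

lemma hopf_vertical_scaleR_left:
  assumes "hopf_vertical (c *\<^sub>R q) v" "c \<noteq> 0"
  shows "hopf_vertical q v"
proof -
  have "oct_mult k (fst v) \<bullet> snd q + oct_mult k (fst q) \<bullet> snd v = 0" for k
  proof -
    have "c * (oct_mult k (fst v) \<bullet> snd q + oct_mult k (fst q) \<bullet> snd v) = 0"
      using assms by (simp add: hopf_vertical_def oct_mult.scaleR_right distrib_left)
    then show ?thesis using assms by simp
  qed
  then show ?thesis using assms by (simp add: hopf_vertical_def)
qed

text \<open>On the line of slope \<open>m\<close> the radius determines x \<bullet> x through (1 + m
  \<bullet> m)(x \<bullet> x) = r^2, and kx \<bullet> mx = (k \<bullet> m)(x \<bullet> x). On the
  line at infinity the first component vanishes.\<close>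

lemma hopf_leaf_invariant:
  assumes "L \<in> octonionic_Hopf_leaves" "p \<in> L" "q \<in> L"
  shows "fst p \<bullet> fst p = fst q \<bullet> fst q" "snd p \<bullet> snd p = snd q \<bullet> snd q"
    and "oct_mult k (fst p) \<bullet> snd p = oct_mult k (fst q) \<bullet> snd q"
proof -
  consider m r where "L = oct_line m \<inter> oct_sphere r"
    | r where "L = oct_line_inf \<inter> oct_sphere r" | "L = {(0, 0)}"
    using assms(1) unfolding octonionic_Hopf_leaves_def by blast
  then have "fst p \<bullet> fst p = fst q \<bullet> fst q \<and> snd p \<bullet> snd p = snd q \<bullet> snd q \<and>
     oct_mult k (fst p) \<bullet> snd p = oct_mult k (fst q) \<bullet> snd q"
  proof cases
    case 1
    then obtain x y where p: "p = (x, oct_mult m x)" and q: "q = (y, oct_mult m y)"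
      and "x \<bullet> x + (m \<bullet> m) * (x \<bullet> x) = r\<^sup>2" "y \<bullet> y + (m \<bullet> m) * (y \<bullet> y) = r\<^sup>2"
      using assms(2,3) by (auto simp: oct_line_def oct_sphere_def power2_norm_eq_inner oct_mult_inner_left)
    then have "(1 + m \<bullet> m) * (x \<bullet> x) = (1 + m \<bullet> m) * (y \<bullet> y)" by (simp add: algebra_simps)
    moreover have "1 + m \<bullet> m \<noteq> 0" using inner_ge_zero [of m] by linarith
    ultimately have "x \<bullet> x = y \<bullet> y" by simp
    then show ?thesis by (simp add: p q oct_mult_inner_left oct_mult_inner_right)
  next
    case 2
    then show ?thesis using assms(2,3)
      by (auto simp: oct_line_inf_def oct_sphere_def power2_norm_eq_inner oct_mult.zero_right)
  qed (use assms in auto)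
  then show "fst p \<bullet> fst p = fst q \<bullet> fst q" "snd p \<bullet> snd p = snd q \<bullet> snd q"
    "oct_mult k (fst p) \<bullet> snd p = oct_mult k (fst q) \<bullet> snd q" by blast+
qed

lemma constant_on_derivative_zero:
  fixes h :: "real \<Rightarrow> 'a::real_normed_vector"
  assumes "0 < T" "\<And>t. t \<in> {0..T} \<Longrightarrow> h t = h 0" "(h has_vector_derivative d) (at 0 within {0..T})"
  shows "d = 0"
proof -
  have "(h has_vector_derivative 0) (at 0 within {0..T})"
  proof (rule has_vector_derivative_transform)
    show "h t = h 0" if "t \<in> {0..T}" for t using that by (rule assms(2))
  qed (use assms(1) in simp_all)
  then show ?thesis
    using vector_derivative_unique_within_closed_interval [of 0 T 0 h d 0] assms(1,3) by simp
qed

text \<open>The leaf invariants are constant along the curve and are differentiated there. A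
  one-sided derivative is used so that the lemma applies to flows in nonnegative time.\<close>

lemma hopf_curve_vertical:
  assumes L: "L \<in> octonionic_Hopf_leaves" and T: "0 < T" and \<gamma>: "\<And>t. t \<in> {0..T} \<Longrightarrow> \<gamma> t \<in> L"
    and d: "(\<gamma> has_vector_derivative v) (at 0 within {0..T})"
  shows "hopf_vertical (\<gamma> 0) v"
proof -
  have \<gamma>0: "\<gamma> 0 \<in> L" using \<gamma> T by simp
  define D where "D = at (0::real) within {0..T}"
  have x: "((\<lambda>t. fst (\<gamma> t)) has_vector_derivative fst v) D"
    and y: "((\<lambda>t. snd (\<gamma> t)) has_vector_derivative snd v) D"
    using bounded_linear.has_vector_derivative [OF bounded_linear_fst d]
      bounded_linear.has_vector_derivative [OF bounded_linear_snd d] by (simp_all add: D_def)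
  have kx: "((\<lambda>t. oct_mult k (fst (\<gamma> t))) has_vector_derivative oct_mult k (fst v)) D" for k
    by (rule bounded_linear.has_vector_derivative [OF oct_mult.bounded_linear_right x])
  have inner: "((\<lambda>t. f t \<bullet> g t) has_vector_derivative (f 0 \<bullet> g' + f' \<bullet> g 0)) D"
    if "(f has_vector_derivative f') D" "(g has_vector_derivative g') D" for f g :: "real \<Rightarrow> octonion" and f' g'
    using bounded_bilinear.has_vector_derivative [OF bounded_bilinear_inner that [unfolded D_def]]
    by (simp add: D_def)
  note zero = constant_on_derivative_zero [OF T, folded D_def]
  have "fst (\<gamma> 0) \<bullet> fst v + fst v \<bullet> fst (\<gamma> 0) = 0"
    using hopf_leaf_invariant(1) [OF L _ \<gamma>0] \<gamma> by (intro zero [OF _ inner [OF x x]]) blast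
  moreover have "snd (\<gamma> 0) \<bullet> snd v + snd v \<bullet> snd (\<gamma> 0) = 0"
    using hopf_leaf_invariant(2) [OF L _ \<gamma>0] \<gamma> by (intro zero [OF _ inner [OF y y]]) blast
  moreover have "oct_mult k (fst (\<gamma> 0)) \<bullet> snd v + oct_mult k (fst v) \<bullet> snd (\<gamma> 0) = 0" for k
    using hopf_leaf_invariant(3) [OF L _ \<gamma>0] \<gamma> by (intro zero [OF _ inner [OF kx y]]) blast
  ultimately show ?thesis by (simp add: hopf_vertical_def inner_commute add.commute)
qed

text \<open>At the origin \<open>hopf_vertical\<close> holds for every vector; instead, a curve in
  the leaf of the origin is constant because the squared norms of both components are
  invariant.\<close>

lemma hopf_curve_at_origin:
  assumes L: "L \<in> octonionic_Hopf_leaves" and T: "0 < T" and \<gamma>: "\<And>t. t \<in> {0..T} \<Longrightarrow> \<gamma> t \<in> L"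
    and d: "(\<gamma> has_vector_derivative v) (at 0 within {0..T})" and "\<gamma> 0 = 0"
  shows "v = 0"
proof (rule constant_on_derivative_zero [OF T _ d])
  fix t assume "t \<in> {0..T}"
  then show "\<gamma> t = \<gamma> 0"
    using hopf_leaf_invariant(1,2) [OF L \<gamma> \<gamma>, of t 0] \<open>\<gamma> 0 = 0\<close> T by (simp add: prod_eq_iff)
qed

section \<open>Octonionic lines, their reflections, and perpendicular straight lines\<close>

definition hopf_lines :: "(octonion \<times> octonion) set set" where
  "hopf_lines = insert oct_line_inf (range oct_line)"

lemma hopf_line_cases:
  assumes "l \<in> hopf_lines"
  obtains m where "l = oct_line m" | "l = oct_line_inf"
  using assms by (auto simp: hopf_lines_def)

lemma hopf_leaf_cases:
  assumes "L \<in> octonionic_Hopf_leaves" "p \<in> L" "p \<noteq> 0"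
  obtains l r where "l \<in> hopf_lines" "0 < r" "L = l \<inter> oct_sphere r"
  using assms unfolding octonionic_Hopf_leaves_def hopf_lines_def by (auto simp: zero_prod_def)

lemma hopf_line_subspace:
  assumes "l \<in> hopf_lines"
  shows "subspace l"
  using assms
proof (cases rule: hopf_line_cases)
  case (1 m)
  have "l = range (\<lambda>x. (x, oct_mult m x))" unfolding 1 oct_line_def by auto
  moreover have "linear (\<lambda>x. (x, oct_mult m x))"
    by (rule linearI) (simp_all add: oct_mult.add_right oct_mult.scaleR_right)
  ultimately show ?thesis by (simp add: linear_subspace_image)
qed (auto simp: subspace_def oct_line_inf_def zero_prod_def)

text \<open>All these forms vanish on vertical vectors, and each line has one that is the orthogonal reflection
  in the line.\<close>

definition hopf_form :: "real \<Rightarrow> octonion \<Rightarrow> octonion \<times> octonion \<Rightarrow> octonion \<times> octonion \<Rightarrow> real" where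
  "hopf_form s k p v = s * (fst p \<bullet> fst v - snd p \<bullet> snd v)
     + (oct_mult k (fst v) \<bullet> snd p + oct_mult k (fst p) \<bullet> snd v)"

lemma hopf_vertical_form: "hopf_vertical p v \<Longrightarrow> hopf_form s k p v = 0"
  by (simp add: hopf_vertical_def hopf_form_def)

lemma hopf_form_left_linear:
  "hopf_form s k (a *\<^sub>R p + b *\<^sub>R q) v = a * hopf_form s k p v + b * hopf_form s k q v"
  by (simp add: hopf_form_def oct_mult.add_right oct_mult.scaleR_right inner_add_left inner_add_right algebra_simps)

text \<open>The coefficients (s, k) are the point of the unit sphere in \<real> x \<bbbO> obtained
  from the slope \<open>m\<close> by inverse stereographic projection; the line at infinity
  corresponds to the pole (-1, 0).\<close>

lemma hopf_line_reflection:
  assumes "l \<in> hopf_lines"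
  shows "\<exists>s k. (\<forall>p\<in>l. \<forall>v. hopf_form s k p v = p \<bullet> v) \<and>
     (\<forall>n v. (\<forall>z\<in>l. n \<bullet> z = 0) \<longrightarrow> hopf_form s k n v = - (n \<bullet> v))"
  using assms
proof (cases rule: hopf_line_cases)
  case (1 m)
  define N where "N = 1 + m \<bullet> m"
  have N: "N > 0" unfolding N_def using inner_ge_zero [of m] by linarith
  define s where "s = (1 - m \<bullet> m) / N"
  define k where "k = (2 / N) *\<^sub>R m"
  have form: "s * (a - b) + (oct_mult k x \<bullet> y + oct_mult k x' \<bullet> y') =
      ((1 - m \<bullet> m) * (a - b) + 2 * (oct_mult m x \<bullet> y + oct_mult m x' \<bullet> y')) / N" for a b x y x' y'
    by (simp add: s_def k_def oct_mult.scaleR_left add_divide_distrib distrib_left)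
  show ?thesis
  proof (rule exI [of _ s], rule exI [of _ k], intro conjI ballI allI impI)
    fix p v assume "p \<in> l"
    then obtain x where p: "p = (x, oct_mult m x)" using 1 by (auto simp: oct_line_def)
    show "hopf_form s k p v = p \<bullet> v"
      unfolding hopf_form_def form using N
      by (simp add: p inner_prod_def oct_mult_inner_left inner_commute [of "fst v"] field_simps)
        (simp add: N_def algebra_simps)
  next
    fix n v :: "octonion \<times> octonion" assume n: "\<forall>z\<in>l. n \<bullet> z = 0"
    then have nz: "fst n \<bullet> z + snd n \<bullet> oct_mult m z = 0" for z
      using bspec [OF n, of "(z, oct_mult m z)"] 1 by (auto simp: oct_line_def inner_prod_def)
    \<comment> \<open>For nonzero \<open>m\<close> every \<open>b\<close> is a product
      \<open>oct_mult m z\<close>, so orthogonality to the line can be evaluated at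
      \<open>z\<close>.\<close>
    have "oct_mult m (fst n) \<bullet> b = - (m \<bullet> m) * (snd n \<bullet> b)" for b
    proof (cases "m = 0")
      case False
      then obtain z where z: "oct_mult m z = b" using oct_left_divisible by blast
      have "fst n \<bullet> z = - (snd n \<bullet> b)" using nz [of z] z by simp
      then show ?thesis by (simp add: oct_mult_inner_left flip: z)
    qed (simp add: oct_mult.zero_left)
    moreover have "oct_mult m (fst v) \<bullet> snd n = - (fst n \<bullet> fst v)"
      using nz [of "fst v"] by (simp add: inner_commute)
    ultimately show "hopf_form s k n v = - (n \<bullet> v)"
      unfolding hopf_form_def form using N by (simp add: inner_prod_def field_simps) (simp add: N_def algebra_simps)
  qed
next
  case 2
  show ?thesis
  proof (rule exI [of _ "-1"], rule exI [of _ 0], intro conjI ballI allI impI)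
    fix n v :: "octonion \<times> octonion" assume n: "\<forall>z\<in>l. n \<bullet> z = 0"
    have "snd n \<bullet> snd n = 0" using bspec [OF n, of "(0, snd n)"] 2 by (auto simp: oct_line_inf_def inner_prod_def)
    then show "hopf_form (- 1) 0 n v = - (n \<bullet> v)"
      by (simp add: hopf_form_def inner_prod_def oct_mult.zero_left)
  qed (auto simp: 2 hopf_form_def oct_line_inf_def inner_prod_def oct_mult.zero_left)
qed

text \<open>The complement of a line is again a line of the decomposition, and a vertical vector at
  a nonzero point of it lies in it. This covers perpendicular straight lines at the moment when they
  cross that complement.\<close>

lemma hopf_vertical_orthogonal_line:
  assumes "l \<in> hopf_lines" "p \<in> l" and n: "\<And>z. z \<in> l \<Longrightarrow> n \<bullet> z = 0" "n \<noteq> 0"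
    and v: "hopf_vertical n v"
  shows "p \<bullet> v = 0"
  using assms(1)
proof (cases rule: hopf_line_cases)
  case (1 m)
  then obtain x where p: "p = (x, oct_mult m x)" using \<open>p \<in> l\<close> by (auto simp: oct_line_def)
  obtain c d where cd: "n = (c, d)" by (cases n)
  obtain a b where ab: "v = (a, b)" by (cases v)
  have nz: "c \<bullet> z = - (d \<bullet> oct_mult m z)" for z
    using n(1) [of "(z, oct_mult m z)"] 1 cd by (auto simp: oct_line_def inner_prod_def)
  have vert: "oct_mult k a \<bullet> d + oct_mult k c \<bullet> b = 0" "c \<bullet> a = 0" for k
    using v by (auto simp: hopf_vertical_def cd ab)
  show ?thesis
  proof (cases "m = 0")
    case True
    then have "c \<bullet> c = 0" using nz [of c] by (simp add: oct_mult.zero_left)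
    then have c: "c = 0" by simp
    have "a = 0"
    proof (rule ccontr)
      assume "a \<noteq> 0"
      then obtain k where "oct_mult k a = d" using oct_right_divisible by blast
      then show False using vert(1) [of k] c n(2) cd by (simp add: oct_mult.zero_right zero_prod_def)
    qed
    then show ?thesis by (simp add: p ab inner_prod_def True oct_mult.zero_left)
  next
    case False
    have mc: "oct_mult m c = - (m \<bullet> m) *\<^sub>R d"
    proof (rule vector_eq_ldot [THEN iffD1], rule allI)
      fix w
      obtain z where z: "oct_mult m z = w" using oct_left_divisible [OF False] by blast
      have "w \<bullet> oct_mult m c = (m \<bullet> m) * (c \<bullet> z)"
        by (simp add: oct_mult_inner_left inner_commute flip: z)
      also have "\<dots> = w \<bullet> (- (m \<bullet> m) *\<^sub>R d)" by (simp add: nz z inner_commute)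
      finally show "w \<bullet> oct_mult m c = w \<bullet> (- (m \<bullet> m) *\<^sub>R d)" .
    qed
    have c: "c \<noteq> 0"
    proof
      assume "c = 0"
      then have "d = 0" using mc False by (simp add: oct_mult.zero_right)
      with \<open>c = 0\<close> n(2) cd show False by (simp add: zero_prod_def)
    qed
    \<comment> \<open>Together with \<open>mc\<close> this says that (a, b) is orthogonal to the
      line, as (c, d) is. Writing \<open>w\<close> as kc, the polarised identity and c \<bullet> a =
      0 exchange \<open>a\<close> and \<open>c\<close>.\<close>
    have ma: "oct_mult m a = - (m \<bullet> m) *\<^sub>R b"
    proof (rule vector_eq_ldot [THEN iffD1], rule allI)
      fix w
      obtain k where w: "oct_mult k c = w" using oct_right_divisible [OF c] by blast
      have "w \<bullet> oct_mult m a = - (oct_mult k a \<bullet> oct_mult m c)"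
        using oct_mult_inner_polarized [of k c m a] vert(2) w by simp
      also have "\<dots> = (m \<bullet> m) * (oct_mult k a \<bullet> d)" by (simp add: mc)
      also have "oct_mult k a \<bullet> d = - (w \<bullet> b)" using vert(1) [of k] w by (simp add: eq_neg_iff_add_eq_0)
      also have "(m \<bullet> m) * - (w \<bullet> b) = w \<bullet> (- (m \<bullet> m) *\<^sub>R b)" by simp
      finally show "w \<bullet> oct_mult m a = w \<bullet> (- (m \<bullet> m) *\<^sub>R b)" .
    qed
    have "(m \<bullet> m) * (p \<bullet> v) = (m \<bullet> m) * (x \<bullet> a) - oct_mult m x \<bullet> (- (m \<bullet> m) *\<^sub>R b)"
      by (simp add: p ab inner_prod_def algebra_simps)
    also have "oct_mult m x \<bullet> (- (m \<bullet> m) *\<^sub>R b) = (m \<bullet> m) * (x \<bullet> a)"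
      by (simp only: ma [symmetric] oct_mult_inner_left)
    finally show ?thesis using False by simp
  qed
next
  case 2
  have "snd n \<bullet> snd n = 0" using n(1) [of "(0, snd n)"] 2 by (auto simp: oct_line_inf_def inner_prod_def)
  then have sn: "snd n = 0" by simp
  then have "fst n \<noteq> 0" using n(2) by (simp add: prod_eq_iff)
  then obtain k where "oct_mult k (fst n) = snd v" using oct_right_divisible by blast
  then have "snd v \<bullet> snd v = 0" using v sn unfolding hopf_vertical_def by (metis add_0 inner_zero_right)
  then show ?thesis using \<open>p \<in> l\<close> 2 by (auto simp: oct_line_inf_def inner_prod_def)
qed

text \<open>The great circle through \<open>p\<close> with initial velocity \<open>v\<close> stays
  in the subspace \<open>l\<close>.\<close>

lemma great_circle_tangent:
  assumes l: "subspace l" and p: "p \<in> l \<inter> oct_sphere r" and r: "0 < r" and v: "v \<in> l" "p \<bullet> v = 0"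
  shows "v \<in> tangent_vectors (l \<inter> oct_sphere r) p"
proof -
  have sphere: "q \<in> oct_sphere r \<longleftrightarrow> q \<bullet> q = r\<^sup>2" for q
    by (cases q) (simp add: oct_sphere_def inner_prod_def power2_norm_eq_inner)
  \<comment> \<open>\<open>a\<close> is the angular speed and \<open>w\<close> is \<open>v\<close>
    rescaled to length \<open>r\<close>. For \<open>v = 0\<close> division by zero gives
    \<open>w = 0\<close>, and the curve is constant.\<close>
  define a where "a = norm v / r"
  define w where "w = (1 / a) *\<^sub>R v"
  have a: "v \<bullet> v = a\<^sup>2 * r\<^sup>2" "a *\<^sub>R w = v"
    using r by (auto simp: a_def w_def power_divide power2_norm_eq_inner)
  define c where "c = (\<lambda>t. cos (a * t) *\<^sub>R p + sin (a * t) *\<^sub>R w)"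
  define D where "D = (\<lambda>t. (- a * sin (a * t)) *\<^sub>R p + cos (a * t) *\<^sub>R v)"
  have deriv: "(c has_vector_derivative D t) (at t)" for t
    unfolding c_def D_def has_vector_derivative_def
    by (auto intro!: derivative_eq_intros simp: fun_eq_iff algebra_simps simp flip: a(2))
  have "continuous_on A D" for A unfolding D_def by (intro continuous_intros)
  then have "c C1_differentiable_on {-1<..<1}"
    unfolding C1_differentiable_on_def using deriv by blast
  moreover have "c t \<in> l \<inter> oct_sphere r" for t
  proof
    show "c t \<in> l" unfolding c_def w_def using l p v by (auto intro: subspace_add subspace_scale)
    have "c t \<bullet> c t = (cos (a * t))\<^sup>2 * r\<^sup>2 + (sin (a * t))\<^sup>2 * (w \<bullet> w)"
      using p v(2) by (simp add: c_def w_def inner_simps sphere inner_commute power2_eq_square)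
    also have "\<dots> = r\<^sup>2 * (cos (a * t))\<^sup>2 + r\<^sup>2 * (sin (a * t))\<^sup>2"
      by (cases "a = 0") (simp_all add: w_def a(1) power2_eq_square)
    also have "\<dots> = r\<^sup>2" by (simp flip: distrib_left)
    finally show "c t \<in> oct_sphere r" by (simp add: sphere)
  qed
  moreover have "c 0 = p" "D 0 = v" by (simp_all add: c_def D_def)
  ultimately show ?thesis unfolding tangent_vectors_def
    using deriv [of 0] by (intro CollectI exI [of _ 1] conjI exI [of _ c]) auto
qed

lemma hopf_tangent_vertical:
  assumes "L \<in> octonionic_Hopf_leaves" "w \<in> tangent_vectors L q"
  shows "hopf_vertical q w" and "q = 0 \<Longrightarrow> w = 0"
proof -
  obtain \<epsilon> c where \<epsilon>: "\<epsilon> > 0" and c: "c ` {-\<epsilon><..<\<epsilon>} \<subseteq> L" "c 0 = q" "(c has_vector_derivative w) (at 0)"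
    using assms(2) unfolding tangent_vectors_def by blast
  have in_L: "c t \<in> L" if "t \<in> {0..\<epsilon>/2}" for t using c(1) \<epsilon> that by auto
  have d: "(c has_vector_derivative w) (at 0 within {0..\<epsilon>/2})"
    using c(3) has_vector_derivative_at_within by blast
  have \<epsilon>2: "0 < \<epsilon>/2" using \<epsilon> by simp
  show "hopf_vertical q w" using hopf_curve_vertical [OF assms(1) \<epsilon>2 in_L d] c(2) by simp
  show "w = 0" if "q = 0" using hopf_curve_at_origin [OF assms(1) \<epsilon>2 in_L d] c(2) that by simp
qed

lemma hopf_line_through_perpendicular:
  assumes L: "L \<in> octonionic_Hopf_leaves" "p \<in> L" and L': "L' \<in> octonionic_Hopf_leaves"
    and t: "t \<noteq> 0" and perp: "\<And>v. v \<in> tangent_vectors L p \<Longrightarrow> u \<bullet> v = 0"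
    and w: "w \<in> tangent_vectors L' (p + t *\<^sub>R u)"
  shows "u \<bullet> w = 0"
proof (cases "p = 0")
  \<comment> \<open>A ray from the origin is normal to the spheres that contain the leaves.\<close>
  case True
  have "hopf_vertical (t *\<^sub>R u) w" using hopf_tangent_vertical [OF L' w] True by simp
  then show ?thesis using hopf_vertical_inner [of "t *\<^sub>R u" w] t by simp
next
  case False
  obtain l r where l: "l \<in> hopf_lines" and r: "0 < r" and L_eq: "L = l \<inter> oct_sphere r"
    using hopf_leaf_cases [OF L False] .
  have sub: "subspace l" and p: "p \<in> l" using hopf_line_subspace [OF l] L L_eq by auto
  obtain y n where "y \<in> span l" "\<And>z. z \<in> span l \<Longrightarrow> orthogonal n z" and u: "u = y + n"
    using orthogonal_subspace_decomp_exists [of l u] by blast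
  moreover have "span l = l" using sub by (simp add: span_eq_iff)
  ultimately have y: "y \<in> l" and n: "\<And>z. z \<in> l \<Longrightarrow> n \<bullet> z = 0"
    by (simp_all add: orthogonal_def)
  define lam where "lam = (y \<bullet> p) / (p \<bullet> p)"
  have "y - lam *\<^sub>R p \<in> l" using sub y p by (simp add: subspace_diff subspace_scale)
  moreover have orth: "p \<bullet> (y - lam *\<^sub>R p) = 0"
    using False by (simp add: lam_def inner_diff_right inner_commute)
  \<comment> \<open>The part of \<open>y\<close> orthogonal to \<open>p\<close> is tangent to the
    leaf, so \<open>u\<close> is orthogonal to it; being itself a component of \<open>u\<close>, it
    vanishes.\<close>
  ultimately have "u \<bullet> (y - lam *\<^sub>R p) = 0" "n \<bullet> (y - lam *\<^sub>R p) = 0"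
    using perp n great_circle_tangent [OF sub _ r, of p] L L_eq by auto
  then have "(y - lam *\<^sub>R p) \<bullet> (y - lam *\<^sub>R p) = 0"
    using orth by (simp add: u inner_add_left inner_diff_left)
  then have u: "u = lam *\<^sub>R p + n" using u by simp
  define \<alpha> where "\<alpha> = 1 + t * lam"
  have q: "p + t *\<^sub>R u = \<alpha> *\<^sub>R p + t *\<^sub>R n" by (simp add: u \<alpha>_def algebra_simps)
  note vert = hopf_tangent_vertical [OF L' w, unfolded q]
  obtain s k where "\<forall>z\<in>l. \<forall>v. hopf_form s k z v = z \<bullet> v"
    "\<forall>n v. (\<forall>z\<in>l. n \<bullet> z = 0) \<longrightarrow> hopf_form s k n v = - (n \<bullet> v)"
    using hopf_line_reflection [OF l] by blast
  then have R: "hopf_form s k p w = p \<bullet> w" "hopf_form s k n w = - (n \<bullet> w)"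
    using p n by blast+
  \<comment> \<open>The metric and the reflection form both annihilate \<open>w\<close>; they differ
    only in the sign on \<open>n\<close>, so their sum and difference separate the two
    terms.\<close>
  have "\<alpha> * (p \<bullet> w) + t * (n \<bullet> w) = 0"
    using hopf_vertical_inner [OF vert(1)] by (simp add: inner_add_left)
  moreover have "\<alpha> * (p \<bullet> w) - t * (n \<bullet> w) = 0"
    using hopf_vertical_form [OF vert(1), of s k] by (simp add: hopf_form_left_linear R)
  ultimately have "\<alpha> * (p \<bullet> w) = 0" "t * (n \<bullet> w) = 0" by linarith+
  then have nw: "n \<bullet> w = 0" and pw: "\<alpha> = 0 \<or> p \<bullet> w = 0" using t by auto
  have "p \<bullet> w = 0"
  \<comment> \<open>For \<alpha> = 0 the point lies in the complement of \<open>l\<close>: it is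
    either the origin, where tangent vectors vanish, or a nonzero multiple of
    \<open>n\<close>.\<close>
  proof (cases "\<alpha> = 0")
    case True
    show ?thesis
    proof (cases "n = 0")
      case True
      then have "w = 0" using vert(2) \<open>\<alpha> = 0\<close> by simp
      then show ?thesis by simp
    next
      case False
      have "hopf_vertical n w" using vert(1) True t hopf_vertical_scaleR_left by simp
      from hopf_vertical_orthogonal_line [OF l p n False this] show ?thesis .
    qed
  qed (use pw in blast)
  then show ?thesis using nw by (simp add: u inner_add_left)
qed

text \<open>Comparison with 0 gives Gx \<bullet> z = -(Gz \<bullet> x), whose right-hand side is
  linear in \<open>x\<close>. The hypothesis is the Killing equation in terms of
  differences.\<close>

lemma linear_if_skew:
  fixes G :: "'a::real_inner \<Rightarrow> 'a"
  assumes skew: "\<And>p q. (G q - G p) \<bullet> (q - p) = 0" and "G 0 = 0"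
  shows "linear G"
proof -
  have self: "G p \<bullet> p = 0" for p using skew [of p 0] \<open>G 0 = 0\<close> by simp
  have G: "G x \<bullet> z = - (G z \<bullet> x)" for x z
    using skew [of x z] self [of x] self [of z] by (simp add: inner_simps algebra_simps)
  show ?thesis
  proof (rule linearI)
    show "G (x + y) = G x + G y" for x y
    proof (rule vector_eq_rdot [THEN iffD1], rule allI)
      show "G (x + y) \<bullet> z = (G x + G y) \<bullet> z" for z
        using G [of "x + y" z] G [of x z] G [of y z] by (simp add: inner_add_left inner_add_right)
    qed
    show "G (c *\<^sub>R x) = c *\<^sub>R G x" for c x
    proof (rule vector_eq_rdot [THEN iffD1], rule allI)
      show "G (c *\<^sub>R x) \<bullet> z = (c *\<^sub>R G x) \<bullet> z" for z
        using G [of "c *\<^sub>R x" z] G [of x z] by simp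
    qed
  qed
qed

text \<open>A linear field tangent to all leaves consists of right multiplications by an element of the
  nucleus of the octonions.\<close>

lemma linear_hopf_vertical_zero:
  assumes lin: "linear L" and vert: "\<And>p. hopf_vertical p (L p)"
  shows "L p = 0"
proof -
  define P where "P x = fst (L (x, 0))" for x
  define Q where "Q y = snd (L (0, y))" for y
  have L0: "L (0, 0) = 0" using linear_0 [OF lin] by (simp add: zero_prod_def)
  \<comment> \<open>Verticality at (x, 0) makes this component orthogonal to all kx, and these
    exhaust the octonions. Hence \<open>L\<close> is block diagonal.\<close>
  have 1: "snd (L (x, 0)) = 0" for x
  proof (cases "x = 0")
    case False
    then obtain k where k: "oct_mult k x = snd (L (x, 0))" using oct_right_divisible by blast
    have "oct_mult k x \<bullet> snd (L (x, 0)) = 0"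
      using vert [of "(x, 0)"] by (simp add: hopf_vertical_def)
    then show ?thesis by (simp add: k)
  qed (simp add: L0)
  have 2: "fst (L (0, y)) = 0" for y
  proof (rule ccontr)
    assume nz: "fst (L (0, y)) \<noteq> 0"
    then obtain k where k: "oct_mult k (fst (L (0, y))) = y" using oct_right_divisible by blast
    have "oct_mult k (fst (L (0, y))) \<bullet> y = 0"
      using vert [of "(0, y)"] by (simp add: hopf_vertical_def oct_mult.zero_right)
    then have "y = 0" by (simp add: k)
    then show False using nz L0 by simp
  qed
  have L: "L (x, y) = (P x, Q y)" for x y
    using linear_add [OF lin, of "(x, 0)" "(0, y)"] by (simp add: P_def Q_def 1 2 prod_eq_iff)
  have v: "x \<bullet> P x = 0" "y \<bullet> Q y = 0" "oct_mult k (P x) \<bullet> y + oct_mult k x \<bullet> Q y = 0" for x y k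
    using vert [of "(x, y)"] by (simp_all add: hopf_vertical_def L)
  have Q_add: "Q (y + z) = Q y + Q z" for y z
    using linear_add [OF lin, of "(0, y)" "(0, z)"] by (simp add: L)
  have Q_skew: "y \<bullet> Q z = - (z \<bullet> Q y)" for y z
    using v(2) [of "y + z"] v(2) [of y] v(2) [of z] by (simp add: Q_add inner_simps)
  \<comment> \<open>Skewness of \<open>Q\<close> turns the mixed equation of verticality into an
    intertwining relation. With x = 1 it gives Q k = kc, with k = 1 it gives P = Q, and it then
    reads k(xc) = (kx)c, the nucleus condition.\<close>
  have PQ: "oct_mult k (P x) = Q (oct_mult k x)" for k x
  proof (rule vector_eq_rdot [THEN iffD1], rule allI)
    show "oct_mult k (P x) \<bullet> y = Q (oct_mult k x) \<bullet> y" for y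
      using v(3) [of k x y] Q_skew [of "oct_mult k x" y] by (simp add: inner_commute [of y])
  qed
  define c where "c = P (axis 0 1)"
  have Q: "Q k = oct_mult k c" for k
    using PQ [of k "axis 0 1"] by (simp add: c_def oct_mult_one_right)
  have P: "P x = oct_mult x c" for x
    using PQ [of "axis 0 1" x] by (simp add: oct_mult_one_left Q)
  have "c = c $ 0 *\<^sub>R axis 0 1"
    using PQ by (intro oct_nucleus) (simp add: P Q)
  moreover have "c $ 0 = 0"
    using v(1) [of "axis 0 1"] by (simp add: P oct_mult_one_left inner_axis')
  ultimately have "c = 0" by simp
  then show ?thesis
    by (cases p) (simp add: L P Q oct_mult.zero_right zero_prod_def)
qed

lemma closed_hopf_vertical: "closed {v. hopf_vertical p v}"
proof -
  have "continuous_on UNIV (oct_mult k)" for k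
    using oct_mult.bounded_linear_right linear_continuous_on by blast
  then have "continuous_on UNIV (\<lambda>v. oct_mult k (fst v))" for k
    by (rule continuous_on_compose2) (auto intro: continuous_intros)
  then show ?thesis unfolding hopf_vertical_def
    by (intro closed_Collect_conj closed_Collect_eq closed_Collect_all continuous_intros)
qed

lemma hopf_vertical_scaleR_right: "hopf_vertical p v \<Longrightarrow> hopf_vertical p (c *\<^sub>R v)"
  by (simp add: hopf_vertical_def oct_mult.scaleR_right flip: distrib_left)

text \<open>For \<open>p \<noteq> 0\<close> this exhibits a second point of the leaf, as the final
  contradiction requires.\<close>

lemma hopf_leaf_uminus:
  assumes "L \<in> octonionic_Hopf_leaves" "p \<in> L"
  shows "- p \<in> L"
proof (cases "p = 0")
  case False
  from assms False obtain l r where "l \<in> hopf_lines" "L = l \<inter> oct_sphere r"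
    by (rule hopf_leaf_cases)
  then show ?thesis
    using assms(2) subspace_neg [OF hopf_line_subspace] by (cases p) (auto simp: oct_sphere_def)
qed (use assms in simp)

lemma hopf_leaf_norm:
  assumes "L \<in> octonionic_Hopf_leaves" "p \<in> L" "q \<in> L"
  shows "norm p = norm q"
  using hopf_leaf_invariant(1,2) [OF assms] by (simp add: norm_eq_sqrt_inner inner_prod_def)

section \<open>Geodesics and Lie derivatives of the standard metric\<close>

lemma geodesic_standard_metric:
  fixes \<gamma> :: "real \<Rightarrow> 'a::euclidean_space"
  assumes "geodesic standard_metric I \<gamma>"
  shows "\<exists>u. (\<forall>t\<in>I. vector_derivative \<gamma> (at t) = u) \<and> (\<forall>s\<in>I. \<forall>t\<in>I. \<gamma> t = \<gamma> s + (t - s) *\<^sub>R u)"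
proof -
  have "christoffel standard_metric p u v w = 0" for p u v w :: 'a
    by (simp add: christoffel_def standard_metric_def)
  with assms have I: "is_interval I" and
    "\<exists>\<gamma>' \<gamma>''. \<forall>t\<in>I. (\<gamma> has_vector_derivative \<gamma>' t) (at t) \<and>
      (\<gamma>' has_vector_derivative \<gamma>'' t) (at t) \<and> \<gamma>'' t = 0"
    by (simp_all add: geodesic_def standard_metric_def)
  then obtain \<gamma>' \<gamma>'' where \<gamma>: "\<forall>t\<in>I. (\<gamma> has_vector_derivative \<gamma>' t) (at t) \<and>
      (\<gamma>' has_vector_derivative \<gamma>'' t) (at t) \<and> \<gamma>'' t = 0"
    by blast
  have d1: "(\<gamma> has_vector_derivative \<gamma>' t) (at t)" and d2: "(\<gamma>' has_vector_derivative 0) (at t)"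
    if "t \<in> I" for t
    using bspec [OF \<gamma> that] by auto
  have conv: "convex I" using I by (simp add: is_interval_convex)
  have "(\<gamma>' has_vector_derivative 0) (at t within I)" if "t \<in> I" for t
    using has_vector_derivative_at_within [OF d2 [OF that]] .
  then obtain u where u: "\<And>t. t \<in> I \<Longrightarrow> \<gamma>' t = u"
    using has_vector_derivative_zero_constant [OF conv] by blast
  have "((\<lambda>t. \<gamma> t - t *\<^sub>R u) has_vector_derivative 0) (at t within I)" if "t \<in> I" for t
  proof -
    have "((\<lambda>t. \<gamma> t - t *\<^sub>R u) has_vector_derivative u - 1 *\<^sub>R u) (at t within I)"
      using has_vector_derivative_at_within [OF d1 [OF that], of I] u [OF that]
      by (auto intro!: derivative_eq_intros)
    then show ?thesis by simp
  qed
  then obtain c where c: "\<And>t. t \<in> I \<Longrightarrow> \<gamma> t - t *\<^sub>R u = c"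
    using has_vector_derivative_zero_constant [OF conv] by blast
  show ?thesis
  proof (intro exI [of _ u] conjI ballI)
    show "vector_derivative \<gamma> (at t) = u" if "t \<in> I" for t
      using d1 u that vector_derivative_at by metis
    show "\<gamma> t = \<gamma> s + (t - s) *\<^sub>R u" if "s \<in> I" "t \<in> I" for s t
      using c [OF that(1)] c [OF that(2)] by (simp add: algebra_simps)
  qed
qed

lemma real_analytic_differentiable:
  fixes f :: "'a::euclidean_space \<Rightarrow> 'b::euclidean_space"
  assumes "f real_analytic_on U" "p \<in> U"
  shows "f differentiable (at p)"
  using real_analytic_expansion [OF assms] expansion_has_derivative
  unfolding differentiable_def by metis

text \<open>The finitely many coefficients in the standard basis are continuous at \<open>p\<close>,
  hence bounded nearby, which gives one constant for all \<open>q\<close> and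
  \<open>v\<close>.\<close>

lemma one_form_bound:
  assumes "open U" "\<omega> \<in> one_forms U" "p \<in> U"
  shows "\<exists>K\<ge>0. \<forall>\<^sub>F q in nhds p. \<forall>v. \<bar>\<omega> q v\<bar> \<le> K * norm v"
proof -
  have \<omega>: "linear (\<omega> q)" if "q \<in> U" for q using assms(2) that by (simp add: one_forms_def)
  have "\<forall>\<^sub>F q in nhds p. \<bar>\<omega> q b\<bar> < \<bar>\<omega> p b\<bar> + 1" for b
  proof -
    have "(\<lambda>q. \<omega> q b) differentiable (at p)"
      using assms by (intro real_analytic_differentiable [of _ U]) (auto simp: one_forms_def)
    then have "isCont (\<lambda>q. \<bar>\<omega> q b\<bar>) p"
      by (intro continuous_rabs differentiable_imp_continuous_within)
    then have "((\<lambda>q. \<bar>\<omega> q b\<bar>) \<longlongrightarrow> \<bar>\<omega> p b\<bar>) (nhds p)"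
      unfolding isCont_def tendsto_at_iff_tendsto_nhds [of "\<lambda>q. \<bar>\<omega> q b\<bar>"] .
    then show ?thesis by (rule order_tendstoD) simp
  qed
  then have near: "\<forall>\<^sub>F q in nhds p. \<forall>b\<in>Basis. \<bar>\<omega> q b\<bar> < \<bar>\<omega> p b\<bar> + 1"
    by (simp add: eventually_ball_finite)
  define K where "K = (\<Sum>b\<in>(Basis::'a set). \<bar>\<omega> p b\<bar> + 1)"
  have "\<forall>\<^sub>F q in nhds p. q \<in> U" using assms by (simp add: eventually_nhds_in_open)
  with near have "\<forall>\<^sub>F q in nhds p. \<forall>v. \<bar>\<omega> q v\<bar> \<le> K * norm v"
  proof eventually_elim
    case (elim q)
    show ?case
    proof
      fix v
      have "\<omega> q v = \<omega> q (\<Sum>b\<in>Basis. (v \<bullet> b) *\<^sub>R b)" by (simp add: euclidean_representation)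
      also have "\<dots> = (\<Sum>b\<in>Basis. (v \<bullet> b) * \<omega> q b)"
        using \<omega> [OF elim(2)] by (simp add: linear_sum linear_scale)
      also have "\<bar>\<dots>\<bar> \<le> (\<Sum>b\<in>Basis. norm v * (\<bar>\<omega> p b\<bar> + 1))"
      proof (rule order_trans [OF sum_abs], rule sum_mono)
        fix b :: 'a assume b: "b \<in> Basis"
        show "\<bar>(v \<bullet> b) * \<omega> q b\<bar> \<le> norm v * (\<bar>\<omega> p b\<bar> + 1)"
          unfolding abs_mult using elim(1) b Basis_le_norm [OF b, of v]
          by (intro mult_mono) (auto intro: less_imp_le)
      qed
      finally show "\<bar>\<omega> q v\<bar> \<le> K * norm v"
        by (simp add: K_def sum_distrib_left mult.commute)
    qed
  qed
  moreover have "0 \<le> K" unfolding K_def by (intro sum_nonneg) simp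
  ultimately show ?thesis by blast
qed

lemma lie_derivative_standard_metric:
  "lie_derivative_metric X standard_metric p v v = 2 * (frechet_derivative X (at p) v \<bullet> v)"
  by (simp add: lie_derivative_metric_def standard_metric_def inner_commute)

text \<open>Mean value theorem along the segment from \<open>p\<close> to \<open>q\<close>: the
  derivative of X \<bullet> (q - p) is half the Lie derivative of the metric on (q - p, q - p). This
  brings the estimate into the form used by \<open>linear_if_skew\<close>.\<close>

lemma killing_bound:
  assumes X: "X real_analytic_on U" "ball 0 \<delta> \<subseteq> U"
    and bound: "\<And>p v. norm p < \<delta> \<Longrightarrow> \<bar>lie_derivative_metric X standard_metric p v v\<bar> \<le> C * norm p ^ k * (norm v)\<^sup>2"
    and C: "0 \<le> C" and pq: "norm p \<le> R" "norm q \<le> R" "R < \<delta>"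
  shows "\<bar>(X q - X p) \<bullet> (q - p)\<bar> \<le> C * R ^ k * (norm (q - p))\<^sup>2"
proof -
  define \<phi> where "\<phi> t = X (p + t *\<^sub>R (q - p)) \<bullet> (q - p)" for t
  define \<phi>' where "\<phi>' t = frechet_derivative X (at (p + t *\<^sub>R (q - p))) (q - p) \<bullet> (q - p)" for t
  have in_cball: "norm (p + t *\<^sub>R (q - p)) \<le> R" if "0 \<le> t" "t \<le> 1" for t
  proof -
    have "(1 - t) *\<^sub>R p + t *\<^sub>R q \<in> cball 0 R"
      using that pq by (intro convexD [OF convex_cball]) auto
    then show ?thesis by (simp add: algebra_simps)
  qed
  have "(\<phi> has_real_derivative \<phi>' t) (at t)" if "0 \<le> t" "t \<le> 1" for t
  proof -
    have "X differentiable at (p + t *\<^sub>R (q - p))"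
      using in_cball [OF that] pq X by (intro real_analytic_differentiable [OF X(1)]) auto
    then have D: "(X has_derivative frechet_derivative X (at (p + t *\<^sub>R (q - p)))) (at (p + t *\<^sub>R (q - p)))"
      by (simp add: frechet_derivative_works)
    have "((\<lambda>t. p + t *\<^sub>R (q - p)) has_derivative (\<lambda>t. t *\<^sub>R (q - p))) (at t)"
      by (auto intro!: derivative_eq_intros)
    from has_derivative_compose [OF this D]
    have "(\<phi> has_derivative (\<lambda>s. frechet_derivative X (at (p + t *\<^sub>R (q - p))) (s *\<^sub>R (q - p)) \<bullet> (q - p))) (at t)"
      unfolding \<phi>_def by (rule has_derivative_inner_left)
    then show ?thesis
      unfolding has_field_derivative_def \<phi>'_def
      by (simp add: linear_scale [OF has_derivative_linear [OF D]] mult.commute [of _ "frechet_derivative _ _ _ \<bullet> _"])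
  qed
  from MVT2 [OF zero_less_one this]
  obtain t where t: "0 < t" "t < 1" "\<phi> 1 - \<phi> 0 = \<phi>' t" by auto
  have "\<bar>(X q - X p) \<bullet> (q - p)\<bar> = \<bar>\<phi>' t\<bar>"
    using t(3) by (simp add: \<phi>_def inner_diff_left)
  also have "\<dots> \<le> \<bar>2 * \<phi>' t\<bar>" by simp
  also have "\<dots> \<le> C * norm (p + t *\<^sub>R (q - p)) ^ k * (norm (q - p))\<^sup>2"
    unfolding \<phi>'_def lie_derivative_standard_metric [symmetric]
    using in_cball [of t] t pq by (intro bound) auto
  also have "\<dots> \<le> C * R ^ k * (norm (q - p))\<^sup>2"
    using in_cball [of t] t C by (intro mult_left_mono mult_right_mono power_mono) auto
  finally show ?thesis .
qed

section \<open>Foliations with the Hopf leaves\<close>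

locale hopf_foliation =
  fixes F :: "(octonion \<times> octonion) field_sheaf"
  assumes foliation: "singular_foliation F"
    and leaves: "leaf_decomposition F = octonionic_Hopf_leaves"
begin

section \<open>Sections are tangent to the leaves, and the Molino property\<close>

lemma leaf_hopf: "leaf F p \<in> octonionic_Hopf_leaves"
  using leaves by (metis leaf_decomposition_def rangeI)

lemma mem_leaf: "p \<in> leaf F p"
  by (simp add: leaf_def)

lemma subsheaf: "subsheaf_of_modules F"
  using foliation by (simp only: singular_foliation_def)

lemma analytic:
  assumes "open U" "X \<in> F U"
  shows "X real_analytic_on U"
proof -
  have "X \<in> vector_fields U"
    using subsheaf [unfolded subsheaf_of_modules_def, THEN conjunct1] assms by blast
  then show ?thesis by (simp add: vector_fields_def)
qed

lemma restriction:
  assumes "open U" "open V" "V \<subseteq> U" "X \<in> F U"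
  shows "restrict X V \<in> F V"
  using subsheaf [unfolded subsheaf_of_modules_def, THEN conjunct2, THEN conjunct1, rule_format, of U V X] assms
  by simp

lemma flow_in_leaf:
  assumes U: "open U" "X \<in> F U" and t: "t \<in> {0..T}"
    and mem: "\<And>t. t \<in> {0..T} \<Longrightarrow> \<gamma> t \<in> U"
    and deriv: "\<And>t. t \<in> {0..T} \<Longrightarrow> (\<gamma> has_vector_derivative X (\<gamma> t)) (at t within {0..T})"
  shows "\<gamma> t \<in> leaf F (\<gamma> 0)"
proof -
  have sub: "{0..t} \<subseteq> {0..T}" using t by auto
  have "flow_step F (\<gamma> 0) (\<gamma> t)"
    unfolding flow_step_def
  proof (intro exI conjI ballI)
    fix s assume "s \<in> {0..t}"
    with sub have s: "s \<in> {0..T}" by blast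
    show "\<gamma> s \<in> U" by (rule mem [OF s])
    show "(\<gamma> has_vector_derivative X (\<gamma> s)) (at s within {0..t})"
      by (rule has_vector_derivative_within_subset [OF deriv [OF s] sub])
  qed (use U t in simp_all)
  then show ?thesis by (simp add: leaf_def)
qed

text \<open>A section has a local integral curve, which stays in the leaf of its starting point and
  has initial velocity \<open>X p\<close>.\<close>

lemma field_tangent:
  assumes "open U" "X \<in> F U" "p \<in> U"
  shows "hopf_vertical p (X p)" and "p = 0 \<Longrightarrow> X p = 0"
proof -
  obtain \<rho> C c where e: "homogeneous_expansion X p \<rho> C c"
    using real_analytic_expansion [OF analytic] assms by metis
  obtain \<delta> where \<delta>: "0 < \<delta>" "cball p \<delta> \<subseteq> U"
    using assms open_contains_cball by blast
  define r where "r = min \<delta> (\<rho> / 4)"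
  have r: "0 < r" "cball p r \<subseteq> U"
    using \<delta> homogeneous_expansionD(1) [OF e] by (auto simp: r_def)
  have "norm (X x - X y) \<le> 8 * C / \<rho> * norm (x - y)" if "x \<in> cball p r" "y \<in> cball p r" for x y
    using expansion_lipschitz [OF e, of "x - p" "y - p"] that
    by (simp add: r_def dist_norm norm_minus_commute)
  then obtain T \<gamma> where T: "0 < T" and \<gamma>0: "\<gamma> 0 = p"
    and mem: "\<And>t. t \<in> {0..T} \<Longrightarrow> \<gamma> t \<in> cball p r"
    and d: "\<And>t. t \<in> {0..T} \<Longrightarrow> (\<gamma> has_vector_derivative X (\<gamma> t)) (at t within {0..T})"
    using local_flow_exists [OF r(1), of p X] by metis
  have in_U: "\<gamma> t \<in> U" if "t \<in> {0..T}" for t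
    using mem [OF that] r(2) by blast
  have L: "\<gamma> t \<in> leaf F p" if "t \<in> {0..T}" for t
    using flow_in_leaf [OF assms(1,2) that in_U d] \<gamma>0 by simp
  have d0: "(\<gamma> has_vector_derivative X p) (at 0 within {0..T})" using d [of 0] T \<gamma>0 by simp
  show "hopf_vertical p (X p)" using hopf_curve_vertical [OF leaf_hopf T L d0] \<gamma>0 by simp
  show "X p = 0" if "p = 0" using hopf_curve_at_origin [OF leaf_hopf T L d0] \<gamma>0 that by simp
qed

lemma molino: "molino_singular_riemannian standard_metric F"
  unfolding molino_singular_riemannian_def perpendicular_to_leaf_def
proof (intro allI impI ballI)
  fix I \<gamma> s t w
  assume g: "geodesic standard_metric I \<gamma>" and I: "s \<in> I" "t \<in> I"
    and perp: "\<forall>v\<in>tangent_vectors (leaf F (\<gamma> s)) (\<gamma> s).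
      standard_metric (\<gamma> s) (vector_derivative \<gamma> (at s)) v = 0"
    and w: "w \<in> tangent_vectors (leaf F (\<gamma> t)) (\<gamma> t)"
  obtain u where u: "\<forall>t\<in>I. vector_derivative \<gamma> (at t) = u"
    and line: "\<forall>s\<in>I. \<forall>t\<in>I. \<gamma> t = \<gamma> s + (t - s) *\<^sub>R u"
    using geodesic_standard_metric [OF g] by blast
  have line: "\<gamma> t = \<gamma> s + (t - s) *\<^sub>R u" using line I by blast
  show "standard_metric (\<gamma> t) (vector_derivative \<gamma> (at t)) w = 0"
  proof (cases "t = s")
    case False
    have "w \<in> tangent_vectors (leaf F (\<gamma> t)) (\<gamma> s + (t - s) *\<^sub>R u)"
      using w unfolding line [symmetric] .
    moreover have "u \<bullet> v = 0" if "v \<in> tangent_vectors (leaf F (\<gamma> s)) (\<gamma> s)" for v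
      using bspec [OF perp that] u I(1) by (simp add: standard_metric_def)
    ultimately have "u \<bullet> w = 0"
      using hopf_line_through_perpendicular [OF leaf_hopf mem_leaf leaf_hopf, of "t - s" "\<gamma> s" u] False
      by simp
    then show ?thesis using u I(2) by (simp add: standard_metric_def)
  qed (use perp w in blast)
qed

text \<open>Each symmetric product pairs a locally bounded 1-form with the dual of a section that
  vanishes to order \<open>k\<close>.\<close>

lemma lie_derivative_bound:
  assumes "module_singular_riemannian standard_metric F" and U: "open U" "0 \<in> U" "X \<in> F U"
    and order: "\<And>Y. Y \<in> F U \<Longrightarrow> \<exists>C\<ge>0. \<forall>\<^sub>F p in nhds 0. norm (Y p) \<le> C * norm p ^ k"
  shows "\<exists>C\<ge>0. \<forall>\<^sub>F p in nhds 0. \<forall>v.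
    \<bar>lie_derivative_metric X standard_metric p v v\<bar> \<le> C * norm p ^ k * (norm v)\<^sup>2"
proof -
  obtain N :: nat and \<omega> Y where
    fields: "\<forall>i<N. \<omega> i \<in> one_forms U \<and> Y i \<in> F U"
    and lie: "\<forall>p\<in>U. \<forall>v w. lie_derivative_metric X standard_metric p v w =
      (\<Sum>i<N. sym_product (\<omega> i p) (standard_metric p (Y i p)) v w)"
    using assms(1) [unfolded module_singular_riemannian_def, rule_format, OF conjI, OF U(1,3)] by blast
  have \<omega>: "\<omega> i \<in> one_forms U" and Y: "Y i \<in> F U" if "i < N" for i
    using fields that by blast+
  have eq: "lie_derivative_metric X standard_metric p v v =
      (\<Sum>i<N. sym_product (\<omega> i p) (standard_metric p (Y i p)) v v)" if "p \<in> U" for p v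
    using lie that by blast
  have "\<exists>D\<ge>0. \<forall>\<^sub>F p in nhds 0. \<forall>v. \<bar>\<omega> i p v * (Y i p \<bullet> v)\<bar> \<le> D * norm p ^ k * (norm v)\<^sup>2"
    if i: "i < N" for i
  proof -
    obtain K where K: "K \<ge> 0" "\<forall>\<^sub>F p in nhds 0. \<forall>v. \<bar>\<omega> i p v\<bar> \<le> K * norm v"
      using one_form_bound [OF U(1) \<omega> [OF i] U(2)] by blast
    obtain C where C: "C \<ge> 0" "\<forall>\<^sub>F p in nhds 0. norm (Y i p) \<le> C * norm p ^ k"
      using order [OF Y [OF i]] by blast
    from K(2) C(2) have "\<forall>\<^sub>F p in nhds 0. \<forall>v. \<bar>\<omega> i p v * (Y i p \<bullet> v)\<bar> \<le> (K * C) * norm p ^ k * (norm v)\<^sup>2"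
    proof eventually_elim
      case (elim p)
      show ?case
      proof
        fix v
        have "\<bar>Y i p \<bullet> v\<bar> \<le> C * norm p ^ k * norm v"
          using Cauchy_Schwarz_ineq2 [of "Y i p" v] mult_right_mono [OF elim(2), of "norm v"] by simp
        then have "\<bar>\<omega> i p v\<bar> * \<bar>Y i p \<bullet> v\<bar> \<le> (K * norm v) * (C * norm p ^ k * norm v)"
          using spec [OF elim(1), of v] K(1) by (intro mult_mono) simp_all
        then show "\<bar>\<omega> i p v * (Y i p \<bullet> v)\<bar> \<le> (K * C) * norm p ^ k * (norm v)\<^sup>2"
          by (simp add: abs_mult power2_eq_square mult_ac)
      qed
    qed
    then show ?thesis using K(1) C(1) by (intro exI [of _ "K * C"]) simp
  qed
  then have "\<forall>i. \<exists>D. i < N \<longrightarrow> 0 \<le> D \<and>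
      (\<forall>\<^sub>F p in nhds 0. \<forall>v. \<bar>\<omega> i p v * (Y i p \<bullet> v)\<bar> \<le> D * norm p ^ k * (norm v)\<^sup>2)"
    by blast
  from choice [OF this] obtain D where D: "\<And>i. i < N \<Longrightarrow> 0 \<le> D i \<and>
      (\<forall>\<^sub>F p in nhds 0. \<forall>v. \<bar>\<omega> i p v * (Y i p \<bullet> v)\<bar> \<le> D i * norm p ^ k * (norm v)\<^sup>2)"
    by blast
  have "\<forall>\<^sub>F p in nhds 0. \<forall>i\<in>{..<N}. \<forall>v. \<bar>\<omega> i p v * (Y i p \<bullet> v)\<bar> \<le> D i * norm p ^ k * (norm v)\<^sup>2"
    using D by (intro eventually_ball_finite ballI) simp_all
  moreover have "\<forall>\<^sub>F p in nhds 0. p \<in> U" using U by (simp add: eventually_nhds_in_open)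
  ultimately have "\<forall>\<^sub>F p in nhds 0. \<forall>v.
    \<bar>lie_derivative_metric X standard_metric p v v\<bar> \<le> (\<Sum>i<N. 2 * D i) * norm p ^ k * (norm v)\<^sup>2"
  proof eventually_elim
    case (elim p)
    show ?case
    proof
      fix v
      have "\<bar>lie_derivative_metric X standard_metric p v v\<bar> \<le> (\<Sum>i<N. \<bar>2 * (\<omega> i p v * (Y i p \<bullet> v))\<bar>)"
        unfolding eq [OF elim(2)] sym_product_def standard_metric_def mult_2 [symmetric] by (rule sum_abs)
      also have "\<dots> \<le> (\<Sum>i<N. 2 * (D i * norm p ^ k * (norm v)\<^sup>2))"
      proof (rule sum_mono)
        fix i assume "i \<in> {..<N}"
        from spec [OF bspec [OF elim(1) this], of v]
        show "\<bar>2 * (\<omega> i p v * (Y i p \<bullet> v))\<bar> \<le> 2 * (D i * norm p ^ k * (norm v)\<^sup>2)"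
          by linarith
      qed
      finally show "\<bar>lie_derivative_metric X standard_metric p v v\<bar> \<le> (\<Sum>i<N. 2 * D i) * norm p ^ k * (norm v)\<^sup>2"
        by (simp add: sum_distrib_right mult.assoc)
    qed
  qed
  moreover have "0 \<le> (\<Sum>i<N. 2 * D i)" using D by (intro sum_nonneg) simp
  ultimately show ?thesis by blast
qed

text \<open>The Lie derivative of the metric is of order \<open>k\<close>, one order better than the
  first derivatives of the degree \<open>k\<close> part would suggest. Rescaling therefore leaves an
  exact Killing equation for \<open>c k\<close>.\<close>

lemma leading_term_linear:
  assumes "module_singular_riemannian standard_metric F" and U: "open U" "0 \<in> U" "X \<in> F U"
    and order: "\<And>Y. Y \<in> F U \<Longrightarrow> \<exists>C\<ge>0. \<forall>\<^sub>F p in nhds 0. norm (Y p) \<le> C * norm p ^ k"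
    and e: "homogeneous_expansion X 0 \<rho> B c" and vanish: "\<And>j v. j < k \<Longrightarrow> c j v = 0" and k: "0 < k"
  shows "linear (c k)"
proof (rule linear_if_skew)
  show "c k 0 = 0" using homogeneous_expansionD(4) [OF e, of k 0 0] k by (metis scaleR_zero_left zero_power)
  fix p q :: "octonion \<times> octonion"
  obtain C where C: "C \<ge> 0" and lie: "\<forall>\<^sub>F p in nhds 0. \<forall>v.
      \<bar>lie_derivative_metric X standard_metric p v v\<bar> \<le> C * norm p ^ k * (norm v)\<^sup>2"
    using lie_derivative_bound [OF assms(1) U order] by blast
  have "\<forall>\<^sub>F p in nhds 0. p \<in> U" using U by (simp add: eventually_nhds_in_open)
  from this lie have "\<forall>\<^sub>F p in nhds 0. p \<in> U \<and> (\<forall>v.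
      \<bar>lie_derivative_metric X standard_metric p v v\<bar> \<le> C * norm p ^ k * (norm v)\<^sup>2)"
    by (rule eventually_conj)
  then obtain \<delta> where \<delta>: "0 < \<delta>" and near: "\<And>p v. norm p < \<delta> \<Longrightarrow> p \<in> U \<and>
      \<bar>lie_derivative_metric X standard_metric p v v\<bar> \<le> C * norm p ^ k * (norm v)\<^sup>2"
    unfolding eventually_nhds_metric by auto
  define R where "R = norm p + norm q"
  define g where "g s = (X (s *\<^sub>R q) /\<^sub>R s ^ k - X (s *\<^sub>R p) /\<^sub>R s ^ k) \<bullet> (q - p)" for s
  have "(g \<longlongrightarrow> (c k q - c k p) \<bullet> (q - p)) (at_right 0)"
    unfolding g_def by (intro tendsto_intros expansion_leading_term [OF e vanish])
  moreover have "(g \<longlongrightarrow> 0) (at_right 0)"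
  proof (rule Lim_null_comparison)
    have "norm (g s) \<le> C * R ^ k * (norm (q - p))\<^sup>2 * s" if s: "0 < s" "s < \<delta> / (R + 1)" for s
    proof -
      have R: "0 \<le> R" by (simp add: R_def)
      have "s * R \<le> s * (R + 1)" using s by simp
      also have "\<dots> < \<delta>" using s R by (simp add: pos_less_divide_eq)
      finally have sR: "s * R < \<delta>" .
      have "\<bar>(X (s *\<^sub>R q) - X (s *\<^sub>R p)) \<bullet> (s *\<^sub>R q - s *\<^sub>R p)\<bar>
          \<le> C * (s * R) ^ k * (norm (s *\<^sub>R q - s *\<^sub>R p))\<^sup>2"
      proof (rule killing_bound [OF analytic [OF U(1,3)]])
        show "ball 0 \<delta> \<subseteq> U" using near by auto
      qed (use near C sR s in \<open>auto simp: R_def\<close>)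
      \<comment> \<open>After division by s^(k+1) a factor \<open>s\<close> remains on the right, so
        \<open>g\<close> tends to 0.\<close>
      also have "\<dots> = (s * s ^ k) * (C * R ^ k * (norm (q - p))\<^sup>2 * s)"
        by (simp flip: scaleR_diff_right add: power_mult_distrib power2_eq_square mult_ac)
      finally have le: "\<bar>(X (s *\<^sub>R q) - X (s *\<^sub>R p)) \<bullet> (s *\<^sub>R q - s *\<^sub>R p)\<bar>
          \<le> (s * s ^ k) * (C * R ^ k * (norm (q - p))\<^sup>2 * s)" .
      have "(X (s *\<^sub>R q) - X (s *\<^sub>R p)) \<bullet> (s *\<^sub>R q - s *\<^sub>R p) = (s * s ^ k) * g s"
        using s by (simp add: g_def flip: scaleR_diff_right)
      then have "(s * s ^ k) * \<bar>g s\<bar> \<le> (s * s ^ k) * (C * R ^ k * (norm (q - p))\<^sup>2 * s)"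
        using le s by (simp add: abs_mult)
      then show ?thesis using s by (simp only: real_norm_def mult_le_cancel_left_pos mult_pos_pos zero_less_power)
    qed
    moreover have "0 < \<delta> / (R + 1)" using \<delta> by (simp add: R_def add_nonneg_pos)
    ultimately show "\<forall>\<^sub>F s in at_right 0. norm (g s) \<le> C * R ^ k * (norm (q - p))\<^sup>2 * s"
      unfolding eventually_at_right_field by blast
  qed (intro tendsto_mult_right_zero tendsto_ident_at)
  ultimately show "(c k q - c k p) \<bullet> (q - p) = 0"
    by (rule tendsto_unique [rotated]) simp
qed

text \<open>Verticality at \<open>s *\<^sub>R p\<close> equals verticality at \<open>p\<close> for s
  > 0. The vertical vectors form a closed set invariant under scaling, so the rescaled limit is
  vertical.\<close>

lemma leading_term_vertical:
  assumes U: "open U" "0 \<in> U" "X \<in> F U"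
    and e: "homogeneous_expansion X 0 \<rho> B c" and vanish: "\<And>j v. j < k \<Longrightarrow> c j v = 0"
  shows "hopf_vertical p (c k p)"
proof -
  have "((\<lambda>s. s *\<^sub>R p) \<longlongrightarrow> 0 *\<^sub>R p) (at_right 0)" by (intro tendsto_intros)
  then have "\<forall>\<^sub>F s in at_right 0. s *\<^sub>R p \<in> U"
    using U by (intro topological_tendstoD) simp_all
  moreover have "\<forall>\<^sub>F s in at_right (0::real). 0 < s" by (rule eventually_at_right_less)
  ultimately have "\<forall>\<^sub>F s in at_right 0. X (s *\<^sub>R p) /\<^sub>R s ^ k \<in> {v. hopf_vertical p v}"
  proof eventually_elim
    case (elim s)
    have "hopf_vertical p (X (s *\<^sub>R p))"
      using hopf_vertical_scaleR_left [OF field_tangent(1) [OF U(1,3) elim(1)]] elim(2) by simp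
    then show ?case by (simp add: hopf_vertical_scaleR_right)
  qed
  from Lim_in_closed_set [OF closed_hopf_vertical this _ expansion_leading_term [OF e vanish]]
  show ?thesis by simp
qed

text \<open>Strong induction on the degree, for all sections simultaneously: at stage
  \<open>k\<close> the fields that the module condition supplies for \<open>X\<close> must
  themselves vanish to order \<open>k\<close>.\<close>

lemma expansion_vanishes:
  assumes module: "module_singular_riemannian standard_metric F"
    and "open U" "0 \<in> U" "X \<in> F U" "homogeneous_expansion X 0 \<rho> B c"
  shows "c k v = 0"
  using assms(2-)
proof (induction k arbitrary: U X \<rho> B c v rule: less_induct)
  case (less k)
  note U = less.prems(1-3) and e = less.prems(4)
  have vanish: "c j v = 0" if "j < k" for j v by (rule less.IH [OF that less.prems])
  show ?case
  proof (cases "k = 0")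
    \<comment> \<open>Degree 0 is the value at the origin, which is zero because the origin is a
      leaf.\<close>
    case True
    have "X differentiable (at 0)"
      using real_analytic_differentiable [OF analytic [OF U(1,3)] U(2)] .
    then have cont: "isCont X 0" by (rule differentiable_imp_continuous_within)
    have "((\<lambda>s. s *\<^sub>R v) \<longlongrightarrow> 0 *\<^sub>R v) (at_right 0)" by (intro tendsto_intros)
    then have "((\<lambda>s. s *\<^sub>R v) \<longlongrightarrow> 0) (at_right 0)" by simp
    from isCont_tendsto_compose [OF cont this]
    have "((\<lambda>s. X (s *\<^sub>R v)) \<longlongrightarrow> X 0) (at_right 0)" .
    moreover have "((\<lambda>s. X (s *\<^sub>R v)) \<longlongrightarrow> c 0 v) (at_right 0)" using expansion_leading_term [OF e, of 0 v] by simp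
    ultimately have "c 0 v = X 0" by (intro tendsto_unique) simp_all
    then show ?thesis using field_tangent(2) [OF U(1,3,2)] True by simp
  next
    case False
    have "\<exists>C\<ge>0. \<forall>\<^sub>F p in nhds 0. norm (Y p) \<le> C * norm p ^ k" if Y: "Y \<in> F U" for Y
    proof -
      obtain \<rho>' B' c' where e': "homogeneous_expansion Y 0 \<rho>' B' c'"
        using real_analytic_expansion [OF analytic [OF U(1) Y] U(2)] .
      note \<rho>' = homogeneous_expansionD(1) [OF e']
      have tail: "norm (Y p) \<le> (2 * B' / \<rho>' ^ k) * norm p ^ k" if "norm p \<le> \<rho>' / 2" for p
        using expansion_tail [OF e' that, of k] less.IH [OF _ U(1,2) Y e'] by (simp add: power_divide)
      have "\<forall>\<^sub>F p :: octonion \<times> octonion in nhds 0. norm p \<le> \<rho>' / 2"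
        unfolding eventually_nhds_metric using \<rho>' by (intro exI [of _ "\<rho>' / 2"]) auto
      then have "\<forall>\<^sub>F p in nhds 0. norm (Y p) \<le> (2 * B' / \<rho>' ^ k) * norm p ^ k"
        by (rule eventually_mono) (rule tail)
      moreover have "0 \<le> 2 * B' / \<rho>' ^ k" using homogeneous_expansionD(2) [OF e'] \<rho>' by simp
      ultimately show ?thesis by blast
    qed
    then have "linear (c k)"
      using leading_term_linear [OF module U _ e vanish] False by blast
    then show ?thesis
      using leading_term_vertical [OF U e vanish] by (rule linear_hopf_vertical_zero)
  qed
qed

lemma field_vanishes:
  assumes "module_singular_riemannian standard_metric F" "open U" "0 \<in> U" "X \<in> F U"
  shows "\<forall>\<^sub>F p in nhds 0. X p = 0"
proof -
  obtain \<rho> B c where e: "homogeneous_expansion X 0 \<rho> B c"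
    using real_analytic_expansion [OF analytic [OF assms(2,4)] assms(3)] .
  have "X p = 0" if "norm p < \<rho>" for p
    using homogeneous_expansionD(3) [OF e that] expansion_vanishes [OF assms e]
    by (simp add: sums_unique2 [OF _ sums_zero])
  then show ?thesis
    unfolding eventually_nhds_metric using homogeneous_expansionD(1) [OF e] by auto
qed

lemma not_module: "\<not> module_singular_riemannian standard_metric F"
proof
  assume module: "module_singular_riemannian standard_metric F"
  have "locally_finitely_generated F"
    using foliation by (simp only: singular_foliation_def)
  from this [unfolded locally_finitely_generated_def, THEN spec, of 0]
  obtain U G where U: "open U" "0 \<in> U" and G: "finite G" "G \<subseteq> F U"
    and span_all: "\<forall>V. open V \<and> V \<subseteq> U \<longrightarrow> F V = module_span V G"
    by (elim exE conjE)
  have span: "F V = module_span V G" if "open V" "V \<subseteq> U" for V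
    using span_all that by blast
  have "\<forall>\<^sub>F p in nhds 0. \<forall>X\<in>G. X p = 0"
    using G field_vanishes [OF module U] by (intro eventually_ball_finite) auto
  moreover have "\<forall>\<^sub>F p in nhds 0. p \<in> U" using U by (simp add: eventually_nhds_in_open)
  ultimately have "\<forall>\<^sub>F p in nhds 0. p \<in> U \<and> (\<forall>X\<in>G. X p = 0)" by eventually_elim blast
  then obtain \<delta> where \<delta>: "0 < \<delta>" and near: "\<And>p. norm p < \<delta> \<Longrightarrow> p \<in> U \<and> (\<forall>X\<in>G. X p = 0)"
    unfolding eventually_nhds_metric by auto
  \<comment> \<open>A section on any open set, restricted to the ball where the generators vanish,
    is a combination of those generators.\<close>
  have vanish: "X p = 0" if "open W" "X \<in> F W" "p \<in> W" "norm p < \<delta>" for W X p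
  proof -
    define V where "V = W \<inter> ball 0 \<delta>"
    have V: "open V" "V \<subseteq> W" "V \<subseteq> U" "p \<in> V" using that near by (auto simp: V_def)
    have "restrict X V \<in> module_span V G"
      using restriction [OF that(1) V(1,2) that(2)] span [OF V(1,3)] by simp
    then obtain f where "restrict X V = (\<lambda>p\<in>V. \<Sum>Y\<in>G. f Y p *\<^sub>R Y p)"
      by (auto simp: module_span_def)
    from fun_cong [OF this, of p] have "X p = (\<Sum>Y\<in>G. f Y p *\<^sub>R Y p)" using V(4) by simp
    also have "\<dots> = 0" using near [OF that(4)] by (intro sum.neutral) simp
    finally show ?thesis .
  qed
  have fixed: "y = x" if step: "flow_step F x y" and x: "norm x < \<delta>" for x y
  proof -
    obtain W X T \<gamma> where W: "open W" "X \<in> F W" and T: "0 \<le> T" "\<gamma> 0 = x" "\<gamma> T = y"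
      and mem: "\<And>t. t \<in> {0..T} \<Longrightarrow> \<gamma> t \<in> W"
      and d: "\<And>t. t \<in> {0..T} \<Longrightarrow> (\<gamma> has_vector_derivative X (\<gamma> t)) (at t within {0..T})"
      using step unfolding flow_step_def by blast
    have "(\<gamma> has_vector_derivative 0) (at t within {0..T})" if t: "t \<in> {0..T}" for t
    proof -
      have "\<gamma> t \<in> leaf F x" using flow_in_leaf [OF W t mem d] T(2) by simp
      \<comment> \<open>Leaves lie in spheres around the origin, so the curve remains in the ball
        for all its time and is constant.\<close>
      then have "norm (\<gamma> t) < \<delta>" using hopf_leaf_norm [OF leaf_hopf _ mem_leaf] x by metis
      then show ?thesis using d [OF t] vanish [OF W mem [OF t]] by simp
    qed
    then obtain a where "\<And>t. t \<in> {0..T} \<Longrightarrow> \<gamma> t = a"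
      using has_vector_derivative_zero_constant [of "{0..T}" \<gamma>] by blast
    then show ?thesis using T by (metis atLeastAtMost_iff order_refl)
  qed
  obtain b :: "octonion \<times> octonion" where b: "b \<in> Basis" using nonempty_Basis by blast
  define p where "p = (\<delta> / 2) *\<^sub>R b"
  have p: "norm p < \<delta>" "p \<noteq> 0" using \<delta> b by (auto simp: p_def)
  \<comment> \<open>The leaf of \<open>p\<close> contains \<open>- p\<close>, yet a chain of flow
    steps starting in the small ball never moves.\<close>
  have "(flow_step F)\<^sup>*\<^sup>* p (- p)"
    using hopf_leaf_uminus [OF leaf_hopf mem_leaf] by (simp add: leaf_def)
  then have "- p = p"
    by (induction rule: rtranclp_induct) (use fixed p(1) in auto)
  then have "p + p = 0" by (metis add.right_inverse)
  then show False using p(2) by (simp flip: scaleR_2)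
qed

end

theorem theorem1:
  fixes F :: "(octonion \<times> octonion) field_sheaf"
  assumes "singular_foliation F"
    and "leaf_decomposition F = octonionic_Hopf_leaves"
  shows "molino_singular_riemannian standard_metric F \<and>
         \<not> module_singular_riemannian standard_metric F"
proof -
  interpret hopf_foliation F by unfold_locales (fact assms)+
  show ?thesis using molino not_module by blast
qed

end
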